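(* Let $m\ge 3$, let $n>0$ be divisible by $4$, let $\mathcal{C}_m,\mathcal{C}_m'$ be $m$-gon categories, let $T$ be a reflective directed $\{m,n\}$ tiling on $\mathcal{C}_m$ of $S_{m,n}$, and let $\tau\colon T\to\Lambda_{\mathcal{C}_m'}$ be an edge-reversal generated by a degree $n$ reflection scheme $\phi$ over $\mathcal{C}_m$. Regard $\phi$ as the group homomorphism $W_{m,n}\to\{1,-1\}^m$ determined by $s_i\mapsto\phi(s_i)$. Then for every automorphism $\gamma\in W_{m,n}$, $\tau$ is $\phi(\gamma)$-symmetric with respect to $\gamma$; that is, $\tau(\gamma(x))=\phi(\gamma)\cdot\tau(x)$ for all $x\in T_2$.
   Context: **The space $S_{m,n}$.** $S_{m,n}$ is the sphere if $\{m,n\}$ is one of the symbols $\{3,3\},\{3,4\},\{4,3\},\{3,5\},\{5,3\}$; the Euclidean plane if it is one of $\{3,6\},\{4,4\},\{6,3\}$; and the hyperbolic plane otherwise (symbols are ordered pairs). **$m$-gon categories.** For $m\ge 3$, an $m$-gon category $\mathcal{C}_m$ has three objects $0,1,2$ and exactly the following (distinct) non-identity morphisms: $s,t\colon 0\to 1$; $d^1,\dots,d^m\colon 1\to 2$; $v^1,\dots,v^m\colon 0\to 2$; with composition satisfying $\{d^i\circ s,\,d^i\circ t\}=\{v^i,v^{i+1}\}$ for $i=1,\dots,m$ (indices mod $m$). The tuple $\delta^{\mathcal{C}_m}\in\{1,-1\}^m$ has $\delta^{\mathcal{C}_m}_i=1$ if $d^i\circ s=v^i$ and $-1$ if $d^i\circ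 t=v^i$. **Directed tilings.** A presheaf $T$ on $\mathcal{C}_m$ has sets $T_0$ (vertices), $T_1$ (edges), $T_2$ (tiles) and structure maps $s,t\colon T_1\to T_0$, $d_1,\dots,d_m\colon T_2\to T_1$, $v_1,\dots,v_m\colon T_2\to T_0$. With $y(i)=\mathrm{Hom}(-,i)$, and $|T|$ the geometric realization with respect to the functor $\mathcal{C}_m\to\mathsf{Top}$ sending $0,1,2$ to a point, an interval and a filled $m$-gon, and $s,t$, $d^1,\dots,d^m$ to the endpoint and successive edge inclusions, a directed $\{m,n\}$ tiling on $\mathcal{C}_m$ of a space $X$ is a presheaf $T$ such that: (1) for each $x\in T_i$ the corresponding map $y(i)\to T$ is levelwise injective; (2) any two distinct tiles have at most one edge in common; (3) each vertex $v$ has exactly $n$ edges $e$ with $s(e)=v$ or $t(e)=v$; (4) $|T|\cong X$. It is reflective if for every edge $e$ lying between two adjacent (distinct) tiles $x_1,x_2$ there is $i$ with $e=d_i(x_1)=d_i(x_2)$. The vertices, edges and tiles of a directed $\{m,n\}$ tiling of $S_{m,n}$ are identified with those of the canonical undirected geometric $\{m,n\}$ tiling of $S_{m,n}$ (by congruent regular $m$-gons, $n$ at each vertex). **Dihedral action, reversal-closed sets.** The dihedral group $\mathsf{D}_m$ of order $2m$ (rotation $r$, reflection $f$) acts on $\{1,-1\}^m$ by $r(\delta_1,\dots,\delta_m)=(\delta_2,\dots,\delta_m,\delta_1)$, $f(\delta_1,\dots,\delta_m)=(-\delta_m,\dots,-\delta_1)$. Products of tuples are componentwise. $\Gamma\subseteq\mathsf{D}_m$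 is reversal-closed for $\delta$ if for all $\sigma_1,\sigma_2\in\Gamma$ there is $\sigma_3\in\Gamma$ with $\delta\cdot\sigma_1(\delta)\cdot\sigma_2(\delta)=\sigma_3(\delta)$. **Direction presheaves.** $\Lambda$ is the presheaf on $\mathcal{C}_m$ with $\Lambda_0=\{*\}$, $\Lambda_1=\{1,-1\}$, $\Lambda_2=\{1,-1\}^m$, $d_i=\pi_i$ the $i$-th projection. $\Lambda_{\mathcal{C}_m'}$ is its sub-presheaf with the same $0$- and $1$-components and $(\Lambda_{\mathcal{C}_m'})_2=\{\delta^{\mathcal{C}_m}\cdot\sigma(\delta^{\mathcal{C}_m'}):\sigma\in\mathsf{D}_m\}$. For $\Gamma$ reversal-closed for the tuple $\delta^{\mathcal{C}''_m}$ of an $m$-gon category $\mathcal{C}''_m$, $\Lambda^\Gamma$ is the sub-presheaf with the same $0$- and $1$-components and $\Lambda^\Gamma_2=\{\delta^{\mathcal{C}''_m}\cdot\sigma(\delta^{\mathcal{C}''_m}):\sigma\in\Gamma\}$. An edge-reversal is a map of presheaves from $T$ to $\Lambda$ or a sub-presheaf. **Reflection schemes.** $\bigstar$ is the presheaf on $\mathcal{C}_m$ consisting of tiles $s_0,s_1,\dots,s_m$ glued only by $d_i(s_i)=d_i(s_0)$ for $i=1,\dots,m$. A degree $n$ reflection scheme over $\mathcal{C}_m$ is a map of presheaves $\phi\colon\bigstar\to\Lambda^\Gamma$, for some such $\Gamma$, with $\phi(s_0)=(1,\dots,1)$. $\tau$ is generated by $\phi$ if for every tile $x\in T_2$ and $i=1,\dots,m$,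 writing $x_i$ for the tile adjacent to $x$ across the edge $d_i(x)$, $\tau(x_i)=\phi(s_i)\cdot\tau(x)$. **Coxeter group.** $W_{m,n}$ is the Coxeter group with generators $s_1,\dots,s_m$ and relations $s_i^2=e$ and $(s_is_{i+1})^{n/2}=e$ (indices mod $m$), with no relation imposed between non-adjacent generators. Fix a base tile $x_0\in T_2$; $W_{m,n}$ acts on the $\{m,n\}$ tiling as a group of automorphisms, with $s_i$ acting as the reflection across the geodesic of $S_{m,n}$ containing the edge $d_i(x_0)$. Since $n/2$ is even, $s_i\mapsto\phi(s_i)$ extends to a homomorphism $\phi\colon W_{m,n}\to\{1,-1\}^m$. *)

theory Defs
  imports "HOL-Analysis.Analysis" "HOL-Algebra.Group_Action"
begin

section \<open>Polygon categories and their presheaves\<close>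

definition cyc_succ :: "nat \<Rightarrow> nat \<Rightarrow> nat" where
  "cyc_succ m i = (if i = m then 1 else Suc i)"

text \<open>Indices run over \<open>{1..m}\<close>. The objects and morphisms of an \<open>m\<close>-gon category are prescribed,
  so it is given by the composites left open: \<open>d\<^sup>i \<circ> s = v\<^sup>k\<close> with \<open>k = ds C i\<close> and
  \<open>d\<^sup>i \<circ> t = v\<^sup>k\<close> with \<open>k = dt C i\<close>.\<close>

record mgon_cat =
  ds :: "nat \<Rightarrow> nat"
  dt :: "nat \<Rightarrow> nat"

definition mgon_category :: "nat \<Rightarrow> mgon_cat \<Rightarrow> bool" where
  "mgon_category m C \<longleftrightarrow> (\<forall>i\<in>{1..m}. {ds C i, dt C i} = {i, cyc_succ m i})"

definition delta :: "nat \<Rightarrow> mgon_cat \<Rightarrow> nat \<Rightarrow> int" where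
  "delta m C = (\<lambda>i\<in>{1..m}. if ds C i = i then 1 else - 1)"

record ('v, 'e, 't) psh =
  Vert :: "'v set"
  Edge :: "'e set"
  Tile :: "'t set"
  src  :: "'e \<Rightarrow> 'v"
  tgt  :: "'e \<Rightarrow> 'v"
  bd   :: "nat \<Rightarrow> 't \<Rightarrow> 'e"
  corner :: "nat \<Rightarrow> 't \<Rightarrow> 'v"

definition presheaf :: "nat \<Rightarrow> mgon_cat \<Rightarrow> ('v, 'e, 't) psh \<Rightarrow> bool" where
  "presheaf m C T \<longleftrightarrow>
     src T \<in> Edge T \<rightarrow> Vert T \<and> tgt T \<in> Edge T \<rightarrow> Vert T \<and>
     (\<forall>i\<in>{1..m}. bd T i \<in> Tile T \<rightarrow> Edge T \<and> corner T i \<in> Tile T \<rightarrow> Vert T) \<and>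
     (\<forall>i\<in>{1..m}. \<forall>x\<in>Tile T. src T (bd T i x) = corner T (ds C i) x \<and>
                              tgt T (bd T i x) = corner T (dt C i) x)"

record ('v, 'e, 't, 'w, 'f, 'u) psh_map =
  at0 :: "'v \<Rightarrow> 'w"
  at1 :: "'e \<Rightarrow> 'f"
  at2 :: "'t \<Rightarrow> 'u"

definition presheaf_map ::
  "nat \<Rightarrow> ('v, 'e, 't) psh \<Rightarrow> ('w, 'f, 'u) psh \<Rightarrow> ('v, 'e, 't, 'w, 'f, 'u) psh_map \<Rightarrow> bool" where
  "presheaf_map m T U f \<longleftrightarrow>
     at0 f \<in> Vert T \<rightarrow> Vert U \<and> at1 f \<in> Edge T \<rightarrow> Edge U \<and> at2 f \<in> Tile T \<rightarrow> Tile U \<and>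
     (\<forall>e\<in>Edge T. at0 f (src T e) = src U (at1 f e) \<and> at0 f (tgt T e) = tgt U (at1 f e)) \<and>
     (\<forall>i\<in>{1..m}. \<forall>x\<in>Tile T. at1 f (bd T i x) = bd U i (at2 f x) \<and>
                              at0 f (corner T i x) = corner U i (at2 f x))"


section \<open>Geometric realization\<close>

datatype ('v, 'e, 't) cell = VCell 'v | ECell 'e | TCell 't

definition root_corner :: "nat \<Rightarrow> nat \<Rightarrow> complex" where
  "root_corner m k = cis (2 * pi * real k / real m)"

definition cell_body :: "nat \<Rightarrow> ('v, 'e, 't) cell \<Rightarrow> complex set" where
  "cell_body m c = (case c of
      VCell v \<Rightarrow> {0}
    | ECell e \<Rightarrow> closed_segment 0 1
    | TCell x \<Rightarrow> convex hull (root_corner m ` {1..m}))"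

definition cells :: "('v, 'e, 't) psh \<Rightarrow> ('v, 'e, 't) cell set" where
  "cells T = VCell ` Vert T \<union> ECell ` Edge T \<union> TCell ` Tile T"

definition cell_points :: "nat \<Rightarrow> ('v, 'e, 't) psh \<Rightarrow> (('v, 'e, 't) cell \<times> complex) set" where
  "cell_points m T = Sigma (cells T) (cell_body m)"

definition cell_sum :: "nat \<Rightarrow> ('v, 'e, 't) psh \<Rightarrow> (('v, 'e, 't) cell \<times> complex) topology" where
  "cell_sum m T =
     subtopology (prod_topology (discrete_topology (cells T)) euclidean) (cell_points m T)"

text \<open>Let \<open>F\<close> send 0, 1, 2 to a point, an interval and a filled \<open>m\<close>-gon. Every morphism \<open>f\<close>
  identifies \<open>(T(f) x, p)\<close> with \<open>(x, F(f) p)\<close>; the four rules are \<open>f = s, t, d\<^sup>i, v\<^sup>i\<close>. The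
  parametrization \<open>F(d\<^sup>i)\<close> of the \<open>i\<close>-th side starts at \<open>F(d\<^sup>i \<circ> s)\<close> and ends at \<open>F(d\<^sup>i \<circ> t)\<close>.\<close>

inductive glue ::
  "nat \<Rightarrow> mgon_cat \<Rightarrow> ('v, 'e, 't) psh \<Rightarrow> ('v, 'e, 't) cell \<times> complex \<Rightarrow>
   ('v, 'e, 't) cell \<times> complex \<Rightarrow> bool"
  for m C T where
  glue_s: "e \<in> Edge T \<Longrightarrow> glue m C T (VCell (src T e), 0) (ECell e, 0)"
| glue_t: "e \<in> Edge T \<Longrightarrow> glue m C T (VCell (tgt T e), 0) (ECell e, 1)"
| glue_d: "x \<in> Tile T \<Longrightarrow> i \<in> {1..m} \<Longrightarrow> 0 \<le> u \<Longrightarrow> u \<le> 1 \<Longrightarrow>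
     glue m C T (ECell (bd T i x), complex_of_real u)
       (TCell x, (1 - u) *\<^sub>R root_corner m (ds C i) + u *\<^sub>R root_corner m (dt C i))"
| glue_v: "x \<in> Tile T \<Longrightarrow> i \<in> {1..m} \<Longrightarrow>
     glue m C T (VCell (corner T i x), 0) (TCell x, root_corner m i)"

definition glue_equiv ::
  "nat \<Rightarrow> mgon_cat \<Rightarrow> ('v, 'e, 't) psh \<Rightarrow>
   ((('v, 'e, 't) cell \<times> complex) \<times> (('v, 'e, 't) cell \<times> complex)) set" where
  "glue_equiv m C T =
     {(p, q). p \<in> cell_points m T \<and> q \<in> cell_points m T \<and> equivclp (glue m C T) p q}"

definition realization ::
  "nat \<Rightarrow> mgon_cat \<Rightarrow> ('v, 'e, 't) psh \<Rightarrow> (('v, 'e, 't) cell \<times> complex) set topology" where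
  "realization m C T =
     topology (\<lambda>U. U \<subseteq> cell_points m T // glue_equiv m C T \<and> openin (cell_sum m T) (\<Union>U))"

lemma equiv_glue_equiv: "equiv (cell_points m T) (glue_equiv m C T)"
  unfolding equiv_def glue_equiv_def refl_on_def sym_def trans_def
  by (auto intro: equivclp_sym equivclp_trans)

lemma openin_realization:
  "openin (realization m C T) U \<longleftrightarrow>
     U \<subseteq> cell_points m T // glue_equiv m C T \<and> openin (cell_sum m T) (\<Union>U)"
proof -
  have Int: "\<Union>(U \<inter> V) = \<Union>U \<inter> \<Union>V"
    if "U \<subseteq> cell_points m T // glue_equiv m C T" "V \<subseteq> cell_points m T // glue_equiv m C T" for U V
  proof -
    have "A = B" if "A \<in> U" "B \<in> V" "z \<in> A" "z \<in> B" for A B z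
      using quotient_disj[OF equiv_glue_equiv, of A m T C B] that
        \<open>U \<subseteq> _\<close> \<open>V \<subseteq> _\<close> by blast
    then show ?thesis by blast
  qed
  have "istopology (\<lambda>U. U \<subseteq> cell_points m T // glue_equiv m C T \<and> openin (cell_sum m T) (\<Union>U))"
    unfolding istopology_def
  proof (intro conjI allI impI)
    fix U V
    assume "U \<subseteq> cell_points m T // glue_equiv m C T \<and> openin (cell_sum m T) (\<Union>U)"
      and "V \<subseteq> cell_points m T // glue_equiv m C T \<and> openin (cell_sum m T) (\<Union>V)"
    then show "U \<inter> V \<subseteq> cell_points m T // glue_equiv m C T" "openin (cell_sum m T) (\<Union>(U \<inter> V))"
      using Int[of U V] by (auto intro: openin_Int)
  next
    fix K
    assume K: "\<forall>U\<in>K. U \<subseteq> cell_points m T // glue_equiv m C T \<and> openin (cell_sum m T) (\<Union>U)"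
    then show "\<Union>K \<subseteq> cell_points m T // glue_equiv m C T" by blast
    have "\<Union>(\<Union>K) = \<Union>(Union ` K)" by blast
    moreover have "openin (cell_sum m T) (\<Union>(Union ` K))" using K by (intro openin_Union) blast
    ultimately show "openin (cell_sum m T) (\<Union>(\<Union>K))" by simp
  qed
  then show ?thesis unfolding realization_def by (simp add: topology_inverse')
qed


section \<open>The surfaces \<open>S\<^bsub>m,n\<^esub>\<close> and their regular tilings\<close>

text \<open>Each of the three geometries is modelled on a surface in \<open>\<real>\<^sup>3\<close>: the unit sphere, the plane
  at height 1, and the upper sheet of the hyperboloid. In all three cases the geodesics are
  the nonempty sections by linear planes and the convex hull of a finite set is the section of the
  convex cone that it spans.\<close>

datatype geometry = Spherical | Euclidean | Hyperbolic

definition geometry_of :: "nat \<Rightarrow> nat \<Rightarrow> geometry" where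
  "geometry_of m n =
     (if (m, n) \<in> {(3,3), (3,4), (4,3), (3,5), (5,3)} then Spherical
      else if (m, n) \<in> {(3,6), (4,4), (6,3)} then Euclidean else Hyperbolic)"

type_synonym point = "real ^ 3"

definition lorentz :: "point \<Rightarrow> point \<Rightarrow> real" where
  "lorentz x y = x$1 * y$1 + x$2 * y$2 - x$3 * y$3"

fun surface :: "geometry \<Rightarrow> point set" where
  "surface Spherical = {x. norm x = 1}"
| "surface Euclidean = {x. x$3 = 1}"
| "surface Hyperbolic = {x. lorentz x x = - 1 \<and> x$3 > 0}"

fun gdist :: "geometry \<Rightarrow> point \<Rightarrow> point \<Rightarrow> real" where
  "gdist Spherical x y = arccos (x \<bullet> y)"
| "gdist Euclidean x y = dist x y"
| "gdist Hyperbolic x y = arcosh (- lorentz x y)"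

definition S_space :: "nat \<Rightarrow> nat \<Rightarrow> point topology" where
  "S_space m n = subtopology euclidean (surface (geometry_of m n))"

definition isometry :: "geometry \<Rightarrow> (point \<Rightarrow> point) \<Rightarrow> bool" where
  "isometry K g \<longleftrightarrow> bij_betw g (surface K) (surface K) \<and>
     (\<forall>p\<in>surface K. \<forall>q\<in>surface K. gdist K (g p) (g q) = gdist K p q)"

definition geodesic :: "geometry \<Rightarrow> point set \<Rightarrow> bool" where
  "geodesic K L \<longleftrightarrow> (\<exists>H. subspace H \<and> dim H = 2 \<and> L = surface K \<inter> H \<and> L \<noteq> {})"

definition is_reflection :: "geometry \<Rightarrow> point set \<Rightarrow> (point \<Rightarrow> point) \<Rightarrow> bool" where
  "is_reflection K L g \<longleftrightarrow>
     isometry K g \<and> (\<forall>p\<in>L. g p = p) \<and> (\<exists>p\<in>surface K. g p \<noteq> p)"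

definition ghull :: "geometry \<Rightarrow> point set \<Rightarrow> point set" where
  "ghull K P = surface K \<inter> convex_cone hull P"

text \<open>Up to isometry, the vertices of a regular \<open>m\<close>-gon are spaced equally on a circle about
  the point \<open>(0, 0, 1)\<close>. The condition \<open>b > 0\<close> keeps spherical polygons within an
  open hemisphere.\<close>

definition circle_point :: "nat \<Rightarrow> real \<Rightarrow> real \<Rightarrow> nat \<Rightarrow> point" where
  "circle_point m a b k =
     vector [a * cos (2 * pi * real k / real m), a * sin (2 * pi * real k / real m), b]"

definition regular_polygon :: "geometry \<Rightarrow> nat \<Rightarrow> (nat \<Rightarrow> point) \<Rightarrow> bool" where
  "regular_polygon K m p \<longleftrightarrow>
     (\<exists>a b g. 0 < a \<and> 0 < b \<and> isometry K g \<and>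
        (\<forall>k\<in>{1..m}. circle_point m a b k \<in> surface K \<and> p k = g (circle_point m a b k)))"

definition polygon_region :: "geometry \<Rightarrow> nat \<Rightarrow> (nat \<Rightarrow> point) \<Rightarrow> point set \<Rightarrow> bool" where
  "polygon_region K m p F \<longleftrightarrow> regular_polygon K m p \<and> F = ghull K (p ` {1..m})"

definition corners_of :: "geometry \<Rightarrow> nat \<Rightarrow> point set \<Rightarrow> point set" where
  "corners_of K m F = {p k | p k. polygon_region K m p F \<and> k \<in> {1..m}}"

definition sides_of :: "geometry \<Rightarrow> nat \<Rightarrow> point set \<Rightarrow> point set set" where
  "sides_of K m F =
     {ghull K {p k, p (cyc_succ m k)} | p k. polygon_region K m p F \<and> k \<in> {1..m}}"

text \<open>A tiling is given by its set of tiles. The canonical one is determined by the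
  conditions below up to an isometry of the surface.\<close>

definition geometric_tiling :: "geometry \<Rightarrow> nat \<Rightarrow> nat \<Rightarrow> point set set \<Rightarrow> bool" where
  "geometric_tiling K m n \<F> \<longleftrightarrow>
     (\<forall>F\<in>\<F>. \<exists>p. polygon_region K m p F) \<and>
     (\<forall>F\<in>\<F>. \<forall>F'\<in>\<F>. \<exists>g. isometry K g \<and> F' = g ` F) \<and>
     \<Union>\<F> = surface K \<and>
     (\<forall>F\<in>\<F>. \<forall>F'\<in>\<F>. F \<noteq> F' \<longrightarrow>
        F \<inter> F' = {} \<or> (\<exists>v\<in>corners_of K m F \<inter> corners_of K m F'. F \<inter> F' = {v}) \<or>
        F \<inter> F' \<in> sides_of K m F \<inter> sides_of K m F') \<and>
     (\<forall>v\<in>(\<Union>F\<in>\<F>. corners_of K m F). card {F\<in>\<F>. v \<in> corners_of K m F} = n) \<and>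
     (\<forall>p\<in>surface K. \<exists>U. open U \<and> p \<in> U \<and> finite {F\<in>\<F>. F \<inter> U \<noteq> {}})"


section \<open>Directed tilings\<close>

definition tile_edges :: "nat \<Rightarrow> ('v, 'e, 't) psh \<Rightarrow> 't \<Rightarrow> 'e set" where
  "tile_edges m T x = (\<lambda>i. bd T i x) ` {1..m}"

text \<open>The second and third lines of the definition say that the maps \<open>y(1) \<rightarrow> T\<close> and
  \<open>y(2) \<rightarrow> T\<close> are levelwise injective: \<open>y(1)\<close> has vertices \<open>s, t\<close> and one edge, while
  \<open>y(2)\<close> has vertices \<open>v\<^sup>1, \<dots>, v\<^sup>m\<close>, edges \<open>d\<^sup>1, \<dots>, d\<^sup>m\<close> and one tile. For \<open>y(0)\<close>, which is a
  single vertex, nothing is required.\<close>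

definition directed_tiling ::
  "nat \<Rightarrow> nat \<Rightarrow> mgon_cat \<Rightarrow> 'a topology \<Rightarrow> ('v, 'e, 't) psh \<Rightarrow> bool" where
  "directed_tiling m n C X T \<longleftrightarrow>
     presheaf m C T \<and>
     (\<forall>e\<in>Edge T. src T e \<noteq> tgt T e) \<and>
     (\<forall>x\<in>Tile T. inj_on (\<lambda>i. corner T i x) {1..m} \<and> inj_on (\<lambda>i. bd T i x) {1..m}) \<and>
     (\<forall>x\<in>Tile T. \<forall>y\<in>Tile T. x \<noteq> y \<longrightarrow>
        (\<forall>e\<in>tile_edges m T x \<inter> tile_edges m T y. \<forall>e'\<in>tile_edges m T x \<inter> tile_edges m T y.
           e = e')) \<and>
     (\<forall>v\<in>Vert T. card {e\<in>Edge T. src T e = v \<or> tgt T e = v} = n) \<and>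
     realization m C T homeomorphic_space X"

definition reflective :: "nat \<Rightarrow> ('v, 'e, 't) psh \<Rightarrow> bool" where
  "reflective m T \<longleftrightarrow>
     (\<forall>x\<in>Tile T. \<forall>y\<in>Tile T. x \<noteq> y \<longrightarrow>
        (\<forall>e\<in>tile_edges m T x \<inter> tile_edges m T y. \<exists>i\<in>{1..m}. e = bd T i x \<and> e = bd T i y))"

text \<open>An identification of the vertices, edges and tiles of \<open>T\<close> with those of a geometric tiling.
  The cyclic order of the corners is respected, so the side of a tile \<open>x\<close> between its
  corners \<open>i\<close> and \<open>i + 1\<close> is the segment identified with the edge \<open>d\<^sub>i x\<close>.\<close>

record ('v, 'e, 't) placement =
  place0 :: "'v \<Rightarrow> point"
  place1 :: "'e \<Rightarrow> point set"
  place2 :: "'t \<Rightarrow> point set"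

definition identification ::
  "geometry \<Rightarrow> nat \<Rightarrow> ('v, 'e, 't) psh \<Rightarrow> point set set \<Rightarrow> ('v, 'e, 't) placement \<Rightarrow> bool" where
  "identification K m T \<F> \<iota> \<longleftrightarrow>
     bij_betw (place0 \<iota>) (Vert T) (\<Union>F\<in>\<F>. corners_of K m F) \<and>
     bij_betw (place1 \<iota>) (Edge T) (\<Union>F\<in>\<F>. sides_of K m F) \<and>
     bij_betw (place2 \<iota>) (Tile T) \<F> \<and>
     (\<forall>e\<in>Edge T. place1 \<iota> e = ghull K {place0 \<iota> (src T e), place0 \<iota> (tgt T e)}) \<and>
     (\<forall>x\<in>Tile T. polygon_region K m (\<lambda>i. place0 \<iota> (corner T i x)) (place2 \<iota> x))"


section \<open>Sign tuples and direction presheaves\<close>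

definition sign_tuples :: "nat \<Rightarrow> (nat \<Rightarrow> int) set" where
  "sign_tuples m = {1..m} \<rightarrow>\<^sub>E {1, - 1}"

definition tmult :: "nat \<Rightarrow> (nat \<Rightarrow> int) \<Rightarrow> (nat \<Rightarrow> int) \<Rightarrow> nat \<Rightarrow> int" where
  "tmult m a b = (\<lambda>i\<in>{1..m}. a i * b i)"

definition ones :: "nat \<Rightarrow> nat \<Rightarrow> int" where
  "ones m = (\<lambda>i\<in>{1..m}. 1)"

definition sign_group :: "nat \<Rightarrow> (nat \<Rightarrow> int) monoid" where
  "sign_group m = \<lparr>carrier = sign_tuples m, mult = tmult m, one = ones m\<rparr>"

definition rot :: "nat \<Rightarrow> (nat \<Rightarrow> int) \<Rightarrow> nat \<Rightarrow> int" where
  "rot m \<delta> = (\<lambda>i\<in>{1..m}. \<delta> (cyc_succ m i))"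

definition flip :: "nat \<Rightarrow> (nat \<Rightarrow> int) \<Rightarrow> nat \<Rightarrow> int" where
  "flip m \<delta> = (\<lambda>i\<in>{1..m}. - \<delta> (m + 1 - i))"

text \<open>Every element of the dihedral group of order \<open>2 * m\<close> is uniquely \<open>r\<^sup>k\<close> or
  \<open>r\<^sup>k f\<close> with \<open>k < m\<close>; these are encoded as \<open>(k, False)\<close> and \<open>(k, True)\<close>. Only the action
  of the elements is needed below.\<close>

definition dihedral :: "nat \<Rightarrow> (nat \<times> bool) set" where
  "dihedral m = {..<m} \<times> UNIV"

definition dih_act :: "nat \<Rightarrow> nat \<times> bool \<Rightarrow> (nat \<Rightarrow> int) \<Rightarrow> nat \<Rightarrow> int" where
  "dih_act m \<sigma> \<delta> = (rot m ^^ fst \<sigma>) (if snd \<sigma> then flip m \<delta> else \<delta>)"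

definition reversal_closed :: "nat \<Rightarrow> (nat \<times> bool) set \<Rightarrow> (nat \<Rightarrow> int) \<Rightarrow> bool" where
  "reversal_closed m \<Gamma> \<delta> \<longleftrightarrow>
     (\<forall>\<sigma>1\<in>\<Gamma>. \<forall>\<sigma>2\<in>\<Gamma>. \<exists>\<sigma>3\<in>\<Gamma>.
        tmult m (tmult m \<delta> (dih_act m \<sigma>1 \<delta>)) (dih_act m \<sigma>2 \<delta>) = dih_act m \<sigma>3 \<delta>)"

text \<open>The sub-presheaf of the direction presheaf \<open>\<Lambda>\<close> with tiles \<open>A\<close> and all vertices and edges;
  \<open>\<Lambda>\<close> itself is \<open>Lambda_on (sign_tuples m)\<close>.\<close>

definition Lambda_on :: "(nat \<Rightarrow> int) set \<Rightarrow> (unit, int, nat \<Rightarrow> int) psh" where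
  "Lambda_on A = \<lparr>Vert = {()}, Edge = {1, - 1}, Tile = A, src = (\<lambda>_. ()), tgt = (\<lambda>_. ()),
                  bd = (\<lambda>i a. a i), corner = (\<lambda>_ _. ())\<rparr>"

definition Lambda_cat :: "nat \<Rightarrow> mgon_cat \<Rightarrow> mgon_cat \<Rightarrow> (unit, int, nat \<Rightarrow> int) psh" where
  "Lambda_cat m C C' =
     Lambda_on ((\<lambda>\<sigma>. tmult m (delta m C) (dih_act m \<sigma> (delta m C'))) ` dihedral m)"

definition Lambda_sub ::
  "nat \<Rightarrow> mgon_cat \<Rightarrow> (nat \<times> bool) set \<Rightarrow> (unit, int, nat \<Rightarrow> int) psh" where
  "Lambda_sub m C'' \<Gamma> =
     Lambda_on ((\<lambda>\<sigma>. tmult m (delta m C'') (dih_act m \<sigma> (delta m C''))) ` \<Gamma>)"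


section \<open>Reflection schemes\<close>

text \<open>The star is the quotient of the disjoint union of \<open>m + 1\<close> copies of \<open>y(2)\<close>, numbered
  \<open>0, \<dots>, m\<close>, by the gluing \<open>d\<^sub>j(s\<^sub>j) = d\<^sub>j(s\<^sub>0)\<close> and the gluing of endpoints that this forces. An
  edge or a vertex is written \<open>(j, i)\<close> when it is \<open>d\<^sub>i(s\<^sub>j)\<close> or \<open>v\<^sub>i(s\<^sub>j)\<close>; those
  shared with the central tile are represented with \<open>j = 0\<close>.\<close>

definition star_edge :: "nat \<Rightarrow> nat \<Rightarrow> nat \<times> nat" where
  "star_edge j i = (if i = j then (0, i) else (j, i))"

definition star_vert :: "nat \<Rightarrow> nat \<Rightarrow> nat \<Rightarrow> nat \<times> nat" where
  "star_vert m j i = (if i = j \<or> i = cyc_succ m j then (0, i) else (j, i))"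

definition star :: "nat \<Rightarrow> mgon_cat \<Rightarrow> (nat \<times> nat, nat \<times> nat, nat) psh" where
  "star m C =
     \<lparr>Vert = {star_vert m j i | j i. j \<in> {0..m} \<and> i \<in> {1..m}},
      Edge = {star_edge j i | j i. j \<in> {0..m} \<and> i \<in> {1..m}},
      Tile = {0..m},
      src = (\<lambda>(j, i). star_vert m j (ds C i)),
      tgt = (\<lambda>(j, i). star_vert m j (dt C i)),
      bd = (\<lambda>i j. star_edge j i),
      corner = (\<lambda>i j. star_vert m j i)\<rparr>"

lemma presheaf_star:
  assumes "3 \<le> m" "mgon_category m C"
  shows "presheaf m C (star m C)"
proof -
  have C: "{ds C i, dt C i} = {i, cyc_succ m i}" if "i \<in> {1..m}" for i
    using assms(2) that by (auto simp: mgon_category_def)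
  have suc: "cyc_succ m i \<in> {1..m}" if "i \<in> {1..m}" for i
    using that by (auto simp: cyc_succ_def)
  have dsi: "ds C i = i \<or> ds C i = cyc_succ m i" "dt C i = i \<or> dt C i = cyc_succ m i"
    if "i \<in> {1..m}" for i
    using C[OF that] by blast+
  have rng: "ds C i \<in> {1..m}" "dt C i \<in> {1..m}" if "i \<in> {1..m}" for i
    using dsi[OF that] suc[OF that] that by auto
  have z: "star_vert m 0 i = (0, i)" for i
    by (auto simp: star_vert_def)
  have vert: "star_vert m j i \<in> Vert (star m C)" if "j \<le> m" "i \<in> {1..m}" for j i
    using that by (force simp: star_def)
  have edge: "\<exists>j i. e = (j, i) \<and> j \<le> m \<and> i \<in> {1..m}" if "e \<in> Edge (star m C)" for e
    using that by (auto simp: star_def star_edge_def split: if_splits)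
  have "src (star m C) e \<in> Vert (star m C)" "tgt (star m C) e \<in> Vert (star m C)"
    if e: "e \<in> Edge (star m C)" for e
  proof -
    obtain j i where "e = (j, i)" "j \<le> m" "i \<in> {1..m}" using edge[OF e] by blast
    then show "src (star m C) e \<in> Vert (star m C)" "tgt (star m C) e \<in> Vert (star m C)"
      using vert[of j "ds C i"] vert[of j "dt C i"] rng[of i] by (simp_all add: star_def)
  qed
  moreover have "bd (star m C) i x \<in> Edge (star m C)" "corner (star m C) i x \<in> Vert (star m C)"
    if "i \<in> {1..m}" "x \<in> Tile (star m C)" for i x
    using that vert[of x i] by (force simp: star_def)+
  moreover have
    "src (star m C) (bd (star m C) i x) = corner (star m C) (ds C i) x"
    "tgt (star m C) (bd (star m C) i x) = corner (star m C) (dt C i) x"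
    if "i \<in> {1..m}" for i x
    using dsi[OF that] z by (auto simp: star_def star_edge_def star_vert_def)
  ultimately show ?thesis unfolding presheaf_def by blast
qed

text \<open>The degree \<open>n\<close> of a scheme is only the degree of the tilings it is used for and
  imposes no condition on the map.\<close>

definition reflection_scheme ::
  "nat \<Rightarrow> mgon_cat \<Rightarrow> (nat \<times> nat, nat \<times> nat, nat, unit, int, nat \<Rightarrow> int) psh_map \<Rightarrow> bool" where
  "reflection_scheme m C \<phi> \<longleftrightarrow>
     (\<exists>C'' \<Gamma>. mgon_category m C'' \<and> \<Gamma> \<subseteq> dihedral m \<and> reversal_closed m \<Gamma> (delta m C'') \<and>
        presheaf_map m (star m C) (Lambda_sub m C'' \<Gamma>) \<phi>) \<and>
     at2 \<phi> 0 = ones m"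

definition generated_by ::
  "nat \<Rightarrow> ('v, 'e, 't) psh \<Rightarrow> ('v, 'e, 't, unit, int, nat \<Rightarrow> int) psh_map \<Rightarrow>
   (nat \<times> nat, nat \<times> nat, nat, unit, int, nat \<Rightarrow> int) psh_map \<Rightarrow> bool" where
  "generated_by m T \<tau> \<phi> \<longleftrightarrow>
     (\<forall>x\<in>Tile T. \<forall>i\<in>{1..m}. \<forall>y\<in>Tile T. y \<noteq> x \<and> bd T i x \<in> tile_edges m T y \<longrightarrow>
        at2 \<tau> y = tmult m (at2 \<phi> i) (at2 \<tau> x))"


section \<open>The Coxeter group and its action\<close>

text \<open>As the generators are involutions, \<open>W\<^bsub>m,n\<^esub>\<close> is the quotient of the free monoid on
  \<open>{1..m}\<close> by the congruence generated by the Coxeter relations.\<close>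

inductive cox_eq :: "nat \<Rightarrow> nat \<Rightarrow> nat list \<Rightarrow> nat list \<Rightarrow> bool" for m n where
  cox_refl: "w \<in> lists {1..m} \<Longrightarrow> cox_eq m n w w"
| cox_sym: "cox_eq m n u w \<Longrightarrow> cox_eq m n w u"
| cox_trans: "cox_eq m n u v \<Longrightarrow> cox_eq m n v w \<Longrightarrow> cox_eq m n u w"
| cox_square: "u \<in> lists {1..m} \<Longrightarrow> w \<in> lists {1..m} \<Longrightarrow> i \<in> {1..m} \<Longrightarrow>
     cox_eq m n (u @ [i, i] @ w) (u @ w)"
| cox_braid: "u \<in> lists {1..m} \<Longrightarrow> w \<in> lists {1..m} \<Longrightarrow> i \<in> {1..m} \<Longrightarrow>
     cox_eq m n (u @ concat (replicate (n div 2) [i, cyc_succ m i]) @ w) (u @ w)"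

definition cox_class :: "nat \<Rightarrow> nat \<Rightarrow> nat list \<Rightarrow> nat list set" where
  "cox_class m n w = {u. cox_eq m n w u}"

definition cox_gen :: "nat \<Rightarrow> nat \<Rightarrow> nat \<Rightarrow> nat list set" where
  "cox_gen m n i = cox_class m n [i]"

definition coxeter_group :: "nat \<Rightarrow> nat \<Rightarrow> nat list set monoid" where
  "coxeter_group m n =
     \<lparr>carrier = cox_class m n ` lists {1..m},
      mult = (\<lambda>A B. \<Union>a\<in>A. \<Union>b\<in>B. cox_class m n (a @ b)),
      one = cox_class m n []\<rparr>"

lemma cyc_succ_in: "i \<in> {1..m} \<Longrightarrow> cyc_succ m i \<in> {1..m}"
  by (auto simp: cyc_succ_def)

lemma braid_word_in: "i \<in> {1..m} \<Longrightarrow> concat (replicate k [i, cyc_succ m i]) \<in> lists {1..m}"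
  using cyc_succ_in[of i m] by (induction k) auto

lemma cox_eq_lists: "cox_eq m n u w \<Longrightarrow> u \<in> lists {1..m} \<and> w \<in> lists {1..m}"
proof (induction rule: cox_eq.induct)
  case (cox_braid u w i)
  then show ?case using braid_word_in[of i m "n div 2"] by (simp del: set_concat)
qed auto

lemma cox_eq_append1:
  "cox_eq m n u w \<Longrightarrow> x \<in> lists {1..m} \<Longrightarrow> cox_eq m n (x @ u) (x @ w)"
proof (induction rule: cox_eq.induct)
  case (cox_square u w i)
  then show ?case using cox_eq.cox_square[of "x @ u" m w i n] by simp
next
  case (cox_braid u w i)
  then show ?case using cox_eq.cox_braid[of "x @ u" m w i n] by simp
next
  case (cox_refl w)
  then show ?case by (intro cox_eq.cox_refl) auto
qed (auto intro: cox_eq.cox_sym cox_eq.cox_trans)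

lemma cox_eq_append2:
  "cox_eq m n u w \<Longrightarrow> x \<in> lists {1..m} \<Longrightarrow> cox_eq m n (u @ x) (w @ x)"
proof (induction rule: cox_eq.induct)
  case (cox_square u w i)
  then show ?case using cox_eq.cox_square[of u m "w @ x" i n] by simp
next
  case (cox_braid u w i)
  then show ?case using cox_eq.cox_braid[of u m "w @ x" i n] by simp
next
  case (cox_refl w)
  then show ?case by (intro cox_eq.cox_refl) auto
qed (auto intro: cox_eq.cox_sym cox_eq.cox_trans)

lemma cox_class_eq: "cox_eq m n u w \<Longrightarrow> cox_class m n u = cox_class m n w"
  by (auto simp: cox_class_def intro: cox_sym cox_trans)

lemma coxeter_mult:
  assumes "u \<in> lists {1..m}" "w \<in> lists {1..m}"
  shows "cox_class m n u \<otimes>\<^bsub>coxeter_group m n\<^esub> cox_class m n w = cox_class m n (u @ w)"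
proof -
  have *: "cox_class m n (a @ b) = cox_class m n (u @ w)"
    if "a \<in> cox_class m n u" "b \<in> cox_class m n w" for a b
  proof -
    have a: "cox_eq m n u a" and b: "cox_eq m n w b" using that by (auto simp: cox_class_def)
    have "cox_eq m n (u @ w) (a @ w)" using cox_eq_append2[OF a assms(2)] .
    also have "cox_eq m n (a @ w) (a @ b)"
      using cox_eq_append1[OF b] cox_eq_lists[OF a] by blast
    finally (cox_trans) show ?thesis by (simp add: cox_class_eq)
  qed
  have "u \<in> cox_class m n u" "w \<in> cox_class m n w"
    using assms by (auto simp: cox_class_def intro: cox_refl)
  then have "(\<Union>a\<in>cox_class m n u. \<Union>b\<in>cox_class m n w. cox_class m n (a @ b)) =
      cox_class m n (u @ w)"
    using * by blast
  then show ?thesis by (simp add: coxeter_group_def)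
qed

lemma cox_rev: "w \<in> lists {1..m} \<Longrightarrow> cox_eq m n (rev w @ w) []"
proof (induction w)
  case Nil
  then show ?case by (auto intro: cox_refl)
next
  case (Cons i w)
  then have "cox_eq m n (rev w @ [i, i] @ w) (rev w @ w)" by (intro cox_square) auto
  then show ?case using Cons by (auto intro: cox_trans)
qed

lemma group_coxeter_group: "group (coxeter_group m n)"
proof (rule groupI)
  fix x y z
  assume "x \<in> carrier (coxeter_group m n)" "y \<in> carrier (coxeter_group m n)"
    "z \<in> carrier (coxeter_group m n)"
  then obtain u v w where u: "u \<in> lists {1..m}" "x = cox_class m n u"
    and v: "v \<in> lists {1..m}" "y = cox_class m n v"
    and w: "w \<in> lists {1..m}" "z = cox_class m n w"
    by (auto simp: coxeter_group_def)
  have uv: "u @ v \<in> lists {1..m}" and vw: "v @ w \<in> lists {1..m}" using u v w by auto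
  show "x \<otimes>\<^bsub>coxeter_group m n\<^esub> y \<otimes>\<^bsub>coxeter_group m n\<^esub> z =
        x \<otimes>\<^bsub>coxeter_group m n\<^esub> (y \<otimes>\<^bsub>coxeter_group m n\<^esub> z)"
    using coxeter_mult[OF u(1) v(1)] coxeter_mult[OF uv w(1)]
      coxeter_mult[OF v(1) w(1)] coxeter_mult[OF u(1) vw] u v w by simp
next
  fix x y
  assume "x \<in> carrier (coxeter_group m n)" "y \<in> carrier (coxeter_group m n)"
  then obtain u v where u: "u \<in> lists {1..m}" "x = cox_class m n u"
    and v: "v \<in> lists {1..m}" "y = cox_class m n v"
    by (auto simp: coxeter_group_def)
  have "u @ v \<in> lists {1..m}" using u v by auto
  then have "cox_class m n (u @ v) \<in> carrier (coxeter_group m n)"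
    unfolding coxeter_group_def by simp
  then show "x \<otimes>\<^bsub>coxeter_group m n\<^esub> y \<in> carrier (coxeter_group m n)"
    using coxeter_mult[OF u(1) v(1), of n] u v by simp
next
  show "\<one>\<^bsub>coxeter_group m n\<^esub> \<in> carrier (coxeter_group m n)"
    by (auto simp: coxeter_group_def)
next
  fix x
  assume "x \<in> carrier (coxeter_group m n)"
  then obtain u where u: "u \<in> lists {1..m}" "x = cox_class m n u"
    by (auto simp: coxeter_group_def)
  have one: "\<one>\<^bsub>coxeter_group m n\<^esub> = cox_class m n []" by (simp add: coxeter_group_def)
  show "\<one>\<^bsub>coxeter_group m n\<^esub> \<otimes>\<^bsub>coxeter_group m n\<^esub> x = x"
    using coxeter_mult[of "[]" m u n] u one by simp
  have r: "rev u \<in> lists {1..m}" using u by auto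
  have "cox_class m n (rev u) \<in> carrier (coxeter_group m n)"
    using r unfolding coxeter_group_def by simp
  moreover have "cox_class m n (rev u) \<otimes>\<^bsub>coxeter_group m n\<^esub> x = \<one>\<^bsub>coxeter_group m n\<^esub>"
    using coxeter_mult[OF r u(1), of n] u one cox_class_eq[OF cox_rev[OF u(1), of n]] by simp
  ultimately show "\<exists>y\<in>carrier (coxeter_group m n).
      y \<otimes>\<^bsub>coxeter_group m n\<^esub> x = \<one>\<^bsub>coxeter_group m n\<^esub>" by blast
qed

text \<open>The homomorphism \<open>W\<^bsub>m,n\<^esub> \<rightarrow> {1, -1}\<^sup>m\<close> determined by \<open>s\<^sub>i \<mapsto> f i\<close>.\<close>

definition word_sign :: "nat \<Rightarrow> (nat \<Rightarrow> nat \<Rightarrow> int) \<Rightarrow> nat list \<Rightarrow> nat \<Rightarrow> int" where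
  "word_sign m f w = foldr (\<lambda>i. tmult m (f i)) w (ones m)"

definition cox_hom ::
  "nat \<Rightarrow> (nat \<Rightarrow> nat \<Rightarrow> int) \<Rightarrow> nat list set \<Rightarrow> nat \<Rightarrow> int" where
  "cox_hom m f \<gamma> = (THE a. \<exists>w\<in>\<gamma>. a = word_sign m f w)"

lemma word_sign_eq: "word_sign m f w = (\<lambda>j\<in>{1..m}. \<Prod>i\<leftarrow>w. f i j)"
  by (induction w) (auto simp: word_sign_def tmult_def ones_def fun_eq_iff)

lemma word_sign_cong:
  assumes "cox_eq m n u w" "4 dvd n" "\<And>i. i \<in> {1..m} \<Longrightarrow> f i \<in> sign_tuples m"
  shows "word_sign m f u = word_sign m f w"
proof -
  have sq: "f i j * f i j = 1" if "i \<in> {1..m}" "j \<in> {1..m}" for i j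
  proof -
    have "f i j = 1 \<or> f i j = - 1"
      using PiE_mem[OF assms(3)[OF that(1), unfolded sign_tuples_def] that(2)] by simp
    then show ?thesis by auto
  qed
  have "n div 2 = n div 4 + n div 4"
    using assms(2) by presburger
  then obtain k where k: "n div 2 = k + k" by blast
  have pw: "(\<Prod>i\<leftarrow>concat (replicate l [i, i']). f i j) = (f i j * f i' j) ^ l" for l i i' j
    by (induction l) (simp_all add: mult.assoc)
  have br: "(\<Prod>i\<leftarrow>concat (replicate (n div 2) [i, cyc_succ m i]). f i j) = 1"
    if "i \<in> {1..m}" "j \<in> {1..m}" for i j
  proof -
    let ?p = "f i j * f (cyc_succ m i) j"
    have "?p * ?p = (f i j * f i j) * (f (cyc_succ m i) j * f (cyc_succ m i) j)"
      by (simp only: ac_simps)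
    then have "?p * ?p = 1"
      by (simp only: sq[OF that] sq[OF cyc_succ_in[OF that(1)] that(2)])
    then have "?p ^ (k + k) = 1"
      unfolding power_add power_mult_distrib[symmetric] by (simp only: power_one)
    then show ?thesis unfolding k pw by simp
  qed
  show ?thesis
    using assms(1)
  proof (induction rule: cox_eq.induct)
    case (cox_square u w i)
    have "(\<Prod>l\<leftarrow>u @ [i, i] @ w. f l j) = (\<Prod>l\<leftarrow>u @ w. f l j)" if "j \<in> {1..m}" for j
    proof -
      have "(\<Prod>l\<leftarrow>u @ [i, i] @ w. f l j) = (\<Prod>l\<leftarrow>u. f l j) * ((f i j * f i j) * (\<Prod>l\<leftarrow>w. f l j))"
        by (simp add: mult.assoc)
      then show ?thesis by (simp only: sq[OF cox_square(3) that]) simp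
    qed
    then show ?case unfolding word_sign_eq by (intro restrict_ext)
  next
    case (cox_braid u w i)
    have "(\<Prod>l\<leftarrow>u @ concat (replicate (n div 2) [i, cyc_succ m i]) @ w. f l j) = (\<Prod>l\<leftarrow>u @ w. f l j)"
      if "j \<in> {1..m}" for j
      by (simp only: map_append prod_list.append br[OF cox_braid(3) that])
    then show ?case unfolding word_sign_eq by (intro restrict_ext)
  qed auto
qed

lemma cox_hom_class:
  assumes "4 dvd n" "\<And>i. i \<in> {1..m} \<Longrightarrow> f i \<in> sign_tuples m" "w \<in> lists {1..m}"
  shows "cox_hom m f (cox_class m n w) = word_sign m f w"
  unfolding cox_hom_def
proof (rule the_equality)
  show "\<exists>u\<in>cox_class m n w. word_sign m f w = word_sign m f u"
    using cox_refl[OF assms(3), of n] unfolding cox_class_def by blast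
next
  fix a
  assume "\<exists>u\<in>cox_class m n w. a = word_sign m f u"
  then show "a = word_sign m f w"
    using word_sign_cong[OF _ assms(1,2)] by (auto simp: cox_class_def)
qed

lemma cox_hom_gen:
  assumes "4 dvd n" "\<And>i. i \<in> {1..m} \<Longrightarrow> f i \<in> sign_tuples m" "i \<in> {1..m}"
  shows "cox_hom m f (cox_gen m n i) = f i"
proof -
  have "cox_hom m f (cox_gen m n i) = word_sign m f [i]"
    unfolding cox_gen_def using cox_hom_class[OF assms(1,2), where w = "[i]"] assms(3) by simp
  then show ?thesis
    using assms(2)[OF assms(3)]
    by (auto simp: word_sign_eq sign_tuples_def fun_eq_iff PiE_iff extensional_def)
qed

lemma cox_hom_hom:
  assumes "4 dvd n" "\<And>i. i \<in> {1..m} \<Longrightarrow> f i \<in> sign_tuples m"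
  shows "cox_hom m f \<in> hom (coxeter_group m n) (sign_group m)"
proof (rule homI)
  have ws: "word_sign m f w \<in> sign_tuples m" if "w \<in> lists {1..m}" for w
    using that
  proof (induction w)
    case Nil
    then show ?case by (auto simp: word_sign_def ones_def sign_tuples_def)
  next
    case (Cons i w)
    then have "word_sign m f w \<in> sign_tuples m" "f i \<in> sign_tuples m"
      using assms(2) by auto
    then have "word_sign m f w j * f i j \<in> {1, - 1}" if "j \<in> {1..m}" for j
      using that PiE_mem[of "word_sign m f w" "{1..m}" "\<lambda>_. {1, - 1}" j]
        PiE_mem[of "f i" "{1..m}" "\<lambda>_. {1, - 1}" j] unfolding sign_tuples_def by auto
    then show ?case
      unfolding word_sign_def tmult_def sign_tuples_def
      by (intro PiE_I) (auto simp: mult.commute)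
  qed
  show "cox_hom m f x \<in> carrier (sign_group m)" if "x \<in> carrier (coxeter_group m n)" for x
  proof -
    obtain w where w: "w \<in> lists {1..m}" "x = cox_class m n w"
      using \<open>x \<in> carrier (coxeter_group m n)\<close> by (auto simp: coxeter_group_def)
    then show ?thesis
      using cox_hom_class[OF assms w(1)] ws[OF w(1)]
      by (simp add: sign_group_def)
  qed
next
  fix x y
  assume "x \<in> carrier (coxeter_group m n)" "y \<in> carrier (coxeter_group m n)"
  then obtain u v where u: "u \<in> lists {1..m}" "x = cox_class m n u"
    and v: "v \<in> lists {1..m}" "y = cox_class m n v"
    by (auto simp: coxeter_group_def)
  have "u @ v \<in> lists {1..m}" using u v by auto
  then show "cox_hom m f (x \<otimes>\<^bsub>coxeter_group m n\<^esub> y) =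
      cox_hom m f x \<otimes>\<^bsub>sign_group m\<^esub> cox_hom m f y"
    using coxeter_mult[OF u(1) v(1), of n] cox_hom_class[OF assms, where w = u]
      cox_hom_class[OF assms, where w = v] cox_hom_class[OF assms, where w = "u @ v"] u v
    by (auto simp: word_sign_eq sign_group_def tmult_def fun_eq_iff)
qed

text \<open>\<open>act\<close> is an action of \<open>W\<^bsub>m,n\<^esub>\<close> on the surface by isometries which are automorphisms of the
  tiling, in which \<open>s\<^sub>i\<close> is the reflection across the geodesic containing the
  \<open>i\<close>-th edge of the base tile. Such an action is unique, since the generators determine it.\<close>

definition reflection_action ::
  "geometry \<Rightarrow> nat \<Rightarrow> nat \<Rightarrow> ('v, 'e, 't) psh \<Rightarrow> point set set \<Rightarrow> ('v, 'e, 't) placement \<Rightarrow> 't \<Rightarrow>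
   (nat list set \<Rightarrow> point \<Rightarrow> point) \<Rightarrow> bool" where
  "reflection_action K m n T \<F> \<iota> x0 act \<longleftrightarrow>
     group_action (coxeter_group m n) (surface K) act \<and>
     (\<forall>\<gamma>\<in>carrier (coxeter_group m n). isometry K (act \<gamma>) \<and> (\<lambda>F. act \<gamma> ` F) ` \<F> = \<F>) \<and>
     (\<forall>i\<in>{1..m}. \<exists>L. geodesic K L \<and> place1 \<iota> (bd T i x0) \<subseteq> L \<and>
                     is_reflection K L (act (cox_gen m n i)))"

definition tile_action ::
  "('v, 'e, 't) psh \<Rightarrow> ('v, 'e, 't) placement \<Rightarrow> (point \<Rightarrow> point) \<Rightarrow> 't \<Rightarrow> 't" where
  "tile_action T \<iota> g x = inv_into (Tile T) (place2 \<iota>) (g ` place2 \<iota> x)"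

definition symmetric_wrt ::
  "nat \<Rightarrow> ('v, 'e, 't) psh \<Rightarrow> ('v, 'e, 't, unit, int, nat \<Rightarrow> int) psh_map \<Rightarrow> (nat \<Rightarrow> int) \<Rightarrow>
   ('t \<Rightarrow> 't) \<Rightarrow> bool" where
  "symmetric_wrt m T \<tau> \<epsilon> \<gamma> \<longleftrightarrow> (\<forall>x\<in>Tile T. at2 \<tau> (\<gamma> x) = tmult m \<epsilon> (at2 \<tau> x))"

end

theory Submission
  imports Defs
begin

text \<open>Let \<open>g\<close> be the reflection by which \<open>s\<^sub>i\<close> acts. If \<open>g\<close> maps every tile to a tile with the same
  labelling of the edges by \<open>{1..m}\<close>, then crossing an edge commutes with \<open>g\<close>, and both
  \<open>\<tau>(g(x))\<close> and \<open>\<phi>(s\<^sub>i) \<cdot> \<tau>(x)\<close> are multiplied by the same \<open>\<phi>(s\<^sub>k)\<close> along an edge with label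
  \<open>k\<close>; they agree at the base tile because \<open>g(x\<^sub>0)\<close> is its neighbour across \<open>d\<^sub>i(x\<^sub>0)\<close>. Labels
  are preserved since adjacent tiles carry the same label on their common edge, together with the
  direction of that edge, and the labelling of a regular polygon is determined by two consecutive
  corners. Any tile is reached from \<open>x\<^sub>0\<close> by crossing edges, because the surface stays connected
  after removing the countable set of corners.\<close>

text \<open>A tile is placed only as a set of points, and the same set is a regular polygon under
  many numberings of its corners; an isometry is only a distance-preserving bijection. So the
  numbering has to be recovered from the set. In all three models an isometry agrees on the surface
  with a linear map, hence commutes with spanning cones; the corners are the extreme rays of such a
  cone, and neighbouring corners are those at least distance. What remains is the dihedral freedom
  of the numbering. Generators suffice: the reflection in a side of the base tile is shown to act by
  the same factor on the signs of every tile, however far from the base, so along a word the factors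
  simply multiply and no conjugate reflection has to be considered.\<close>

section \<open>Isometries of the model surfaces\<close>

text \<open>A strictly increasing function of the distance, polynomial in the coordinates.\<close>

fun gform :: "geometry \<Rightarrow> point \<Rightarrow> point \<Rightarrow> real" where
  "gform Spherical x y = - (x \<bullet> y)"
| "gform Euclidean x y = (dist x y)\<^sup>2"
| "gform Hyperbolic x y = - lorentz x y"

lemma inner_point: "(x::point) \<bullet> y = x$1 * y$1 + x$2 * y$2 + x$3 * y$3"
  by (simp add: inner_vec_def sum_3)

text \<open>The reverse Cauchy-Schwarz inequality on one sheet. It comes from Lagrange's identity
  for the vectors \<open>(1, x$1, x$2)\<close> and \<open>(1, y$1, y$2)\<close>; the three added
  squares are their minors.\<close>

lemma lorentz_le_minus_1:
  assumes "x \<in> surface Hyperbolic" "y \<in> surface Hyperbolic"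
  shows "lorentz x y \<le> - 1"
proof -
  have x: "(x$3)\<^sup>2 = 1 + (x$1)\<^sup>2 + (x$2)\<^sup>2" "x$3 > 0"
    and y: "(y$3)\<^sup>2 = 1 + (y$1)\<^sup>2 + (y$2)\<^sup>2" "y$3 > 0"
    using assms by (auto simp: lorentz_def power2_eq_square)
  have "(1 + x$1 * y$1 + x$2 * y$2)\<^sup>2 \<le> (1 + x$1 * y$1 + x$2 * y$2)\<^sup>2 +
      ((x$1 - y$1)\<^sup>2 + (x$2 - y$2)\<^sup>2 + (x$1 * y$2 - x$2 * y$1)\<^sup>2)"
    by simp
  also have "\<dots> = (1 + (x$1)\<^sup>2 + (x$2)\<^sup>2) * (1 + (y$1)\<^sup>2 + (y$2)\<^sup>2)"
    by algebra
  also have "\<dots> = (x$3 * y$3)\<^sup>2" unfolding power_mult_distrib x(1) y(1) ..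
  finally have "1 + x$1 * y$1 + x$2 * y$2 \<le> x$3 * y$3"
    by (rule power2_le_imp_le) (use x(2) y(2) in simp)
  then show ?thesis by (simp add: lorentz_def)
qed

text \<open>Bounds on the two forms keep \<open>arccos\<close> and \<open>arcosh\<close> on the
  intervals where they are strictly monotone. Comparing with \<open><\<close> in both orders later
  turns equal distances into equal values of \<open>gform\<close>.\<close>

lemma gdist_less_iff:
  assumes "x \<in> surface K" "y \<in> surface K" "z \<in> surface K" "w \<in> surface K"
  shows "gdist K x y < gdist K z w \<longleftrightarrow> gform K x y < gform K z w"
proof (cases K)
  case Spherical
  have "\<bar>u \<bullet> v\<bar> \<le> 1" if "u \<in> surface K" "v \<in> surface K" for u v
    using that Cauchy_Schwarz_ineq2[of u v] Spherical by simp
  then show ?thesis using assms Spherical by (simp add: arccos_less_mono)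
next
  case Euclidean
  then show ?thesis using power_mono_iff[of "dist z w" "dist x y" 2]
    by (simp flip: not_le)
next
  case Hyperbolic
  have "1 \<le> - lorentz u v" if "u \<in> surface K" "v \<in> surface K" for u v
    using lorentz_le_minus_1[of u v] that Hyperbolic by simp
  then show ?thesis using assms Hyperbolic by simp
qed

lemma isometry_in: "isometry K g \<Longrightarrow> x \<in> surface K \<Longrightarrow> g x \<in> surface K"
  unfolding isometry_def by (meson bij_betwE)

lemma isometry_gform:
  assumes "isometry K g" "x \<in> surface K" "y \<in> surface K"
  shows "gform K (g x) (g y) = gform K x y"
proof -
  have "gdist K (g x) (g y) = gdist K x y" using assms by (auto simp: isometry_def)
  then show ?thesis
    using gdist_less_iff[of "g x" K "g y" x y] gdist_less_iff[of x K y "g x" "g y"]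
      assms isometry_in[OF assms(1)] by simp
qed

lemma isometry_comp:
  assumes "isometry K g" "isometry K h"
  shows "isometry K (g \<circ> h)"
  using assms isometry_in[of K h] unfolding isometry_def by (auto intro: bij_betw_trans)

lemma isometry_inverse:
  assumes "isometry K g"
  obtains h where "isometry K h" "\<And>x. x \<in> surface K \<Longrightarrow> h (g x) = x"
    "\<And>x. x \<in> surface K \<Longrightarrow> g (h x) = x"
proof
  let ?h = "inv_into (surface K) g"
  have b: "bij_betw g (surface K) (surface K)" using assms by (simp add: isometry_def)
  show l: "?h (g x) = x" if "x \<in> surface K" for x
    using b that by (simp add: bij_betw_inv_into_left)
  show r: "g (?h x) = x" if "x \<in> surface K" for x
    using b that by (simp add: bij_betw_inv_into_right)
  have b': "bij_betw ?h (surface K) (surface K)" using b by (rule bij_betw_inv_into)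
  then show "isometry K ?h"
    using assms r bij_betwE[OF b'] unfolding isometry_def by auto metis
qed

text \<open>\<open>M\<close> extends \<open>g\<close> from a basis of the span of \<open>S\<close>
  chosen inside \<open>S\<close>. Then \<open>g x - M x\<close> pairs to zero with every
  \<open>g y\<close>, hence with all of \<open>S\<close>, and nondegeneracy makes it vanish.\<close>

lemma form_preserving_linear:
  fixes B :: "'a::euclidean_space \<Rightarrow> 'a \<Rightarrow> real"
  assumes lin: "\<And>y. linear (\<lambda>x. B x y)"
    and nondeg: "\<And>u. (\<And>z. z \<in> S \<Longrightarrow> B u z = 0) \<Longrightarrow> u = 0"
    and surj: "g ` S = S"
    and pres: "\<And>x y. x \<in> S \<Longrightarrow> y \<in> S \<Longrightarrow> B (g x) (g y) = B x y"
  obtains M where "linear M" "\<And>x. x \<in> S \<Longrightarrow> g x = M x"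
proof -
  obtain A where A: "A \<subseteq> S" "independent A" "S \<subseteq> span A"
    using maximal_independent_subset[of S] by blast
  obtain M where M: "linear M" "\<And>x. x \<in> A \<Longrightarrow> M x = g x"
    using linear_independent_extend[OF A(2), of g] by blast
  have "g x = M x" if x: "x \<in> S" for x
  proof -
    have "B (g x - M x) z = 0" if "z \<in> S" for z
    proof -
      obtain y where y: "y \<in> S" "z = g y" using surj \<open>z \<in> S\<close> by blast
      have "B (M x) z = B x y"
      proof (rule linear_eq_on[where f = "\<lambda>x. B (M x) z" and g = "\<lambda>x. B x y"])
        show "linear (\<lambda>x. B (M x) z)"
          using linear_compose[OF M(1) lin[of z]] by (simp add: o_def)
        show "linear (\<lambda>x. B x y)" by (rule lin)
        show "x \<in> span A" using x A by blast
        show "B (M b) z = B b y" if "b \<in> A" for b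
          using pres[of b y] y A M(2)[OF that] that by auto
      qed
      then show ?thesis
        using pres[OF x y(1)] linear_diff[OF lin[of z], of "g x" "M x"] y by simp
    qed
    then show ?thesis using nondeg[of "g x - M x"] by simp
  qed
  then show thesis using M that by blast
qed

text \<open>The sphere and the hyperboloid carry a nondegenerate bilinear form that isometries
  preserve. On the plane an isometry is affine, and the linear extension is built by hand.\<close>

lemma isometry_linear:
  assumes "isometry K g"
  obtains M where "linear M" "\<And>x. x \<in> surface K \<Longrightarrow> g x = M x"
proof (cases K)
  case Spherical
  have surj: "g ` surface K = surface K" using assms by (simp add: isometry_def bij_betw_def)
  show thesis
  proof (rule form_preserving_linear[where B = inner and S = "surface K" and g = g])
    show "linear (\<lambda>x::point. x \<bullet> y)" for y
      by (simp add: bounded_linear.linear bounded_linear_inner_left)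
    show "u = 0" if u: "\<And>z. z \<in> surface K \<Longrightarrow> u \<bullet> z = 0" for u
    proof -
      have "u $ i = 0" for i
        using u[of "axis i 1"] Spherical by (simp add: inner_axis)
      then show ?thesis by (simp add: vec_eq_iff)
    qed
    show "g x \<bullet> g y = x \<bullet> y" if "x \<in> surface K" "y \<in> surface K" for x y
      using isometry_gform[OF assms that] Spherical by simp
  qed (use surj that in auto)
next
  case Hyperbolic
  have surj: "g ` surface K = surface K" using assms by (simp add: isometry_def bij_betw_def)
  show thesis
  proof (rule form_preserving_linear[where B = lorentz and S = "surface K" and g = g])
    show "linear (\<lambda>x::point. lorentz x y)" for y
      by (rule linearI) (auto simp: lorentz_def algebra_simps)
    show "u = 0" if u: "\<And>z. z \<in> surface K \<Longrightarrow> lorentz u z = 0" for u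
    proof -
      have "lorentz u (vector [0, 0, 1]) = 0" "lorentz u (vector [1, 0, sqrt 2]) = 0"
        "lorentz u (vector [0, 1, sqrt 2]) = 0"
        by (rule u, simp add: Hyperbolic lorentz_def)+
      then show ?thesis by (simp add: lorentz_def vec_eq_iff forall_3)
    qed
    show "lorentz (g x) (g y) = lorentz x y" if "x \<in> surface K" "y \<in> surface K" for x y
      using isometry_gform[OF assms that] Hyperbolic by simp
  qed (use surj that in auto)
next
  case Euclidean
  define e :: point where "e = axis 3 1"
  have e: "e $ 1 = 0" "e $ 2 = 0" "e $ 3 = 1" by (auto simp: e_def axis_def)
  define low where "low x = x - (x $ 3 - 1) *\<^sub>R e" for x :: point
  have low: "low x \<in> surface K" for x using e by (simp add: low_def Euclidean)
  \<comment> \<open>\<open>f\<close> is the planar motion with its translation removed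
    (\<open>low 0 = e\<close> gives \<open>f 0 = 0\<close>), extended by the identity on the
    vertical axis. The translation comes back at the end as the shear term
    \<open>(x $ 3) *\<^sub>R (g e - e)\<close>.\<close>
  define f where "f x = g (low x) - g e + (x $ 3) *\<^sub>R e" for x
  have "orthogonal_transformation f"
    unfolding orthogonal_transformation_isometry
  proof (intro conjI allI)
    show "f 0 = 0" by (simp add: f_def low_def)
    fix x y
    have d: "(dist (g (low x)) (g (low y)))\<^sup>2 = (dist (low x) (low y))\<^sup>2"
      using isometry_gform[OF assms low low, of x y] Euclidean by simp
    have g3: "g (low z) $ 3 = 1" for z
      using isometry_in[OF assms low[of z]] Euclidean by simp
    have "(dist (f x) (f y))\<^sup>2 = (dist (g (low x)) (g (low y)))\<^sup>2 + (x $ 3 - y $ 3)\<^sup>2"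
      unfolding dist_norm power2_norm_eq_inner
      by (simp add: inner_point f_def e g3 power2_eq_square algebra_simps)
    also have "\<dots> = (dist x y)\<^sup>2"
      unfolding d unfolding dist_norm power2_norm_eq_inner
      by (simp add: inner_point low_def e power2_eq_square algebra_simps)
    finally show "dist (f x) (f y) = dist x y" by simp
  qed
  then have lin: "linear f" by (simp add: orthogonal_transformation_linear)
  show thesis
  proof
    show "linear (\<lambda>x. f x + (x $ 3) *\<^sub>R (g e - e))"
      by (rule linearI) (auto simp: linear_add[OF lin] linear_scale[OF lin] algebra_simps)
    show "g x = f x + (x $ 3) *\<^sub>R (g e - e)" if "x \<in> surface K" for x
      using that Euclidean by (simp add: f_def low_def)
  qed
qed

text \<open>On the surface an isometry is linear, and linear maps commute with cone hulls, which
  gives one inclusion; the inverse isometry gives the other.\<close>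

lemma isometry_ghull:
  assumes "isometry K g" "P \<subseteq> surface K"
  shows "g ` ghull K P = ghull K (g ` P)"
proof -
  have sub: "h ` ghull K Q \<subseteq> ghull K (h ` Q)" if h: "isometry K h" "Q \<subseteq> surface K" for h Q
  proof -
    obtain M where M: "linear M" "\<And>x. x \<in> surface K \<Longrightarrow> h x = M x"
      using isometry_linear[OF h(1)] by blast
    have "h ` Q = M ` Q" using M(2) h(2) by (auto intro!: image_cong)
    then have "convex_cone hull (h ` Q) = M ` (convex_cone hull Q)"
      by (simp add: convex_cone_hull_linear_image[OF M(1)])
    then show ?thesis using isometry_in[OF h(1)] M(2) by (auto simp: ghull_def)
  qed
  obtain h where h: "isometry K h" "\<And>x. x \<in> surface K \<Longrightarrow> h (g x) = x"
    "\<And>x. x \<in> surface K \<Longrightarrow> g (h x) = x"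
    using isometry_inverse[OF assms(1)] by blast
  have gP: "g ` P \<subseteq> surface K" using assms isometry_in by blast
  have "h ` (g ` P) = (\<lambda>x. x) ` P"
    unfolding image_image using h(2) assms(2) by (intro image_cong) auto
  then have "h ` ghull K (g ` P) \<subseteq> ghull K P" using sub[OF h(1) gP] by simp
  then have "g ` (h ` ghull K (g ` P)) \<subseteq> g ` ghull K P" by blast
  moreover have "g ` (h ` ghull K (g ` P)) = (\<lambda>x. x) ` ghull K (g ` P)"
    unfolding image_image using h(3) by (intro image_cong) (auto simp: ghull_def)
  ultimately have "ghull K (g ` P) \<subseteq> g ` ghull K P" by simp
  then show ?thesis using sub[OF assms] by blast
qed

section \<open>Regular polygons\<close>

lemma ghull_subset_surface: "ghull K P \<subseteq> surface K"
  by (auto simp: ghull_def)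

lemma ghull_inc: "x \<in> P \<Longrightarrow> x \<in> surface K \<Longrightarrow> x \<in> ghull K P"
  by (simp add: ghull_def hull_inc)

lemma surface_0: "0 \<notin> surface K"
  by (cases K) (auto simp: lorentz_def)

text \<open>Cones only know rays; this turns an equality of rays back into an equality of
  corners.\<close>

lemma surface_ray_unique:
  assumes "x \<in> surface K" "c *\<^sub>R x \<in> surface K" "0 \<le> c"
  shows "c *\<^sub>R x = x"
proof (cases K)
  case Hyperbolic
  have "lorentz (c *\<^sub>R x) (c *\<^sub>R x) = c\<^sup>2 * lorentz x x"
    by (simp add: lorentz_def power2_eq_square algebra_simps)
  then have "c\<^sup>2 = 1" using assms Hyperbolic by simp
  then show ?thesis using assms(3) by (simp add: power2_eq_1_iff)
qed (use assms in auto)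

lemma regular_polygonE:
  assumes "regular_polygon K m p"
  obtains a b h where "0 < a" "0 < b" "isometry K h"
    "\<And>k. k \<in> {1..m} \<Longrightarrow> circle_point m a b k \<in> surface K"
    "\<And>k. k \<in> {1..m} \<Longrightarrow> p k = h (circle_point m a b k)"
proof -
  obtain a b h where "0 < a \<and> 0 < b \<and> isometry K h \<and>
      (\<forall>k\<in>{1..m}. circle_point m a b k \<in> surface K \<and> p k = h (circle_point m a b k))"
    using assms unfolding regular_polygon_def by (elim exE)
  then show thesis by (intro that[of a b h]) simp_all
qed

lemma polygon_region_isometry:
  assumes "isometry K g" "polygon_region K m p F"
  shows "polygon_region K m (g \<circ> p) (g ` F)"
proof -
  obtain a b h where h: "0 < a" "0 < b" "isometry K h"
    "\<And>k. k \<in> {1..m} \<Longrightarrow> circle_point m a b k \<in> surface K"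
    "\<And>k. k \<in> {1..m} \<Longrightarrow> p k = h (circle_point m a b k)"
    by (fact regular_polygonE[OF assms(2)[unfolded polygon_region_def, THEN conjunct1]])
  have "p ` {1..m} \<subseteq> surface K" using h isometry_in[OF h(3)] by auto
  then have "g ` F = ghull K ((g \<circ> p) ` {1..m})"
    using assms isometry_ghull by (simp add: polygon_region_def image_comp)
  moreover have "regular_polygon K m (g \<circ> p)"
    unfolding regular_polygon_def using h isometry_comp[OF assms(1) h(3)]
    by (intro exI[of _ a] exI[of _ b] exI[of _ "g \<circ> h"]) auto
  ultimately show ?thesis by (simp add: polygon_region_def)
qed

lemma regular_polygon_in:
  "regular_polygon K m p \<Longrightarrow> k \<in> {1..m} \<Longrightarrow> p k \<in> surface K"
  unfolding regular_polygon_def using isometry_in by metis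

section \<open>Adjacency of corners read off from distances\<close>

text \<open>Symmetric in \<open>k\<close> and \<open>l\<close>, because distances between corners
  cannot detect the sense of rotation.\<close>

definition cyc_adjacent :: "nat \<Rightarrow> nat \<Rightarrow> nat \<Rightarrow> bool" where
  "cyc_adjacent m k l \<longleftrightarrow> l = cyc_succ m k \<or> k = cyc_succ m l"

text \<open>An index difference \<open>d\<close> can be folded to \<open>m - d\<close> without
  changing the cosine, so it may be taken at most half of \<open>m\<close>, where cosine strictly
  decreases; the largest value is thus attained exactly at difference 1, that is, at
  neighbours.\<close>

lemma cos_cyclic:
  assumes "k \<in> {1..m}" "l \<in> {1..m}" "k \<noteq> l" "3 \<le> m"
  shows "cos (2 * pi * (real k - real l) / real m) \<le> cos (2 * pi / real m)"
    and "cos (2 * pi * (real k - real l) / real m) = cos (2 * pi / real m) \<longleftrightarrow> cyc_adjacent m k l"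
proof -
  have *: "cos (2 * pi * (real k - real l) / real m) \<le> cos (2 * pi / real m) \<and>
    (cos (2 * pi * (real k - real l) / real m) = cos (2 * pi / real m) \<longleftrightarrow> cyc_adjacent m k l)"
    if kl: "k \<in> {1..m}" "l \<in> {1..m}" "l < k" for k l
  proof -
    define d where "d = k - l"
    have d: "1 \<le> d" "d < m" "real k - real l = real d" using kl by (auto simp: d_def)
    have adj: "cyc_adjacent m k l \<longleftrightarrow> d = 1 \<or> d = m - 1"
      using kl \<open>3 \<le> m\<close> by (auto simp: cyc_adjacent_def cyc_succ_def d_def)
    have m: "real m \<ge> 3" using \<open>3 \<le> m\<close> by simp
    have lt: "cos (2 * pi * real e / real m) < cos (2 * pi / real m)" if "1 < e" "2 * e \<le> m" for e :: nat
    proof (rule cos_monotone_0_pi)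
      show "2 * pi / real m < 2 * pi * real e / real m" using that m by (simp add: divide_strict_right_mono)
      have "real e * 2 \<le> real m" using that by linarith
      then show "2 * pi * real e / real m \<le> pi" using m by (simp add: field_simps)
    qed (use m in simp)
    show ?thesis
    proof (cases "2 * d \<le> m")
      case True
      then have "d \<noteq> m - 1" using \<open>3 \<le> m\<close> d by linarith
      then show ?thesis unfolding adj d(3) using lt[of d] d(1) True by (cases "d = 1") auto
    next
      case False
      define e where "e = m - d"
      have e: "1 \<le> e" "2 * e \<le> m" "real e = real m - real d" "e = 1 \<longleftrightarrow> d = m - 1"
        using False d by (auto simp: e_def)
      have "d \<noteq> 1" using \<open>3 \<le> m\<close> False by linarith
      have "cos (2 * pi * real d / real m) = cos (2 * pi - 2 * pi * real d / real m)"
        by (simp add: cos_diff)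
      also have "2 * pi - 2 * pi * real d / real m = 2 * pi * real e / real m"
        using m unfolding e(3) by (simp add: right_diff_distrib diff_divide_distrib)
      finally show ?thesis unfolding adj d(3) using lt[of e] e \<open>d \<noteq> 1\<close> by (cases "e = 1") auto
    qed
  qed
  have sym: "cos (2 * pi * (real k - real l) / real m) = cos (2 * pi * (real l - real k) / real m)"
    using cos_minus[of "2 * pi * (real k - real l) / real m"]
    by (metis minus_diff_eq minus_divide_left mult_minus_right)
  have "cyc_adjacent m k l \<longleftrightarrow> cyc_adjacent m l k" by (auto simp: cyc_adjacent_def)
  then show "cos (2 * pi * (real k - real l) / real m) \<le> cos (2 * pi / real m)"
    "cos (2 * pi * (real k - real l) / real m) = cos (2 * pi / real m) \<longleftrightarrow> cyc_adjacent m k l"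
    using *[of k l] *[of l k] assms sym by (cases "l < k"; simp)+
qed

lemma cos_cyclic_less_1:
  assumes "3 \<le> m"
  shows "cos (2 * pi / real m) < 1"
proof -
  have "cos (2 * pi / real m) < cos 0"
    using assms by (intro cos_monotone_0_pi) (auto simp: field_simps)
  then show ?thesis by simp
qed

text \<open>All corners have the same height and radius, so each form sees only the angle between
  them, through a decreasing affine function of its cosine. The corner combinatorics is thereby
  common to the three geometries.\<close>

lemma gform_circle_point:
  assumes "0 < a"
  obtains \<beta> \<alpha> where "0 < \<beta>"
    "\<And>k l. gform K (circle_point m a b k) (circle_point m a b l) =
       \<alpha> - \<beta> * cos (2 * pi * (real k - real l) / real m)"
proof -
  note that' = that
  define t where "t k = 2 * pi * real k / real m" for k
  have c: "cos (2 * pi * (real k - real l) / real m) = cos (t k) * cos (t l) + sin (t k) * sin (t l)" for k l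
    by (simp add: t_def cos_diff right_diff_distrib diff_divide_distrib)
  have v: "circle_point m a b k = vector [a * cos (t k), a * sin (t k), b]" for k
    by (simp add: circle_point_def t_def)
  have goal: thesis if "0 < \<beta>" "\<And>k l. gform K (circle_point m a b k) (circle_point m a b l) =
      \<alpha> - \<beta> * (cos (t k) * cos (t l) + sin (t k) * sin (t l))" for \<alpha> \<beta>
    using that'[OF that(1), of \<alpha>] that(2) c by simp
  have "0 < a\<^sup>2" using assms by simp
  show thesis
  proof (cases K)
    case Spherical
    show thesis
      by (rule goal[OF \<open>0 < a\<^sup>2\<close>, of "- (b\<^sup>2)"])
        (simp add: Spherical inner_point v power2_eq_square algebra_simps)
  next
    case Hyperbolic
    show thesis
      by (rule goal[OF \<open>0 < a\<^sup>2\<close>, of "b\<^sup>2"])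
        (simp add: Hyperbolic lorentz_def v power2_eq_square algebra_simps)
  next
    case Euclidean
    have "(a * cos s - a * cos t) * (a * cos s - a * cos t) +
        (a * sin s - a * sin t) * (a * sin s - a * sin t) =
        2 * a\<^sup>2 - (2 * a\<^sup>2) * (cos s * cos t + sin s * sin t)" for s t
      using sin_cos_squared_add[of s] sin_cos_squared_add[of t] by algebra
    then show thesis
      by (intro goal[of "2 * a\<^sup>2" "2 * a\<^sup>2"])
        (use assms in \<open>auto simp: Euclidean dist_norm power2_norm_eq_inner inner_point v\<close>)
  qed
qed

text \<open>Adjacency is made metric: \<open>c\<close> is the least value between distinct corners,
  so adjacent pairs can be recognised from the points alone.\<close>

lemma regular_polygon_gform:
  assumes "regular_polygon K m p" "3 \<le> m"
  obtains c where
    "\<And>k l. k \<in> {1..m} \<Longrightarrow> l \<in> {1..m} \<Longrightarrow> k \<noteq> l \<Longrightarrow> c \<le> gform K (p k) (p l)"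
    "\<And>k l. k \<in> {1..m} \<Longrightarrow> l \<in> {1..m} \<Longrightarrow> k \<noteq> l \<Longrightarrow>
       gform K (p k) (p l) = c \<longleftrightarrow> cyc_adjacent m k l"
    "inj_on p {1..m}"
proof -
  obtain a b h where h: "0 < a" "0 < b" "isometry K h"
    and s: "\<And>k. k \<in> {1..m} \<Longrightarrow> circle_point m a b k \<in> surface K"
    and p: "\<And>k. k \<in> {1..m} \<Longrightarrow> p k = h (circle_point m a b k)"
    by (fact regular_polygonE[OF assms(1)])
  obtain \<beta> \<alpha> where ab: "0 < \<beta>"
    "\<And>k l. gform K (circle_point m a b k) (circle_point m a b l) =
       \<alpha> - \<beta> * cos (2 * pi * (real k - real l) / real m)"
    by (fact gform_circle_point[OF h(1)])
  have f: "gform K (p k) (p l) = \<alpha> - \<beta> * cos (2 * pi * (real k - real l) / real m)"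
    if "k \<in> {1..m}" "l \<in> {1..m}" for k l
    using isometry_gform[OF h(3) s s, of k l] that by (simp add: p ab)
  show thesis
  proof (rule that[of "\<alpha> - \<beta> * cos (2 * pi / real m)"])
    fix k l assume kl: "k \<in> {1..m}" "l \<in> {1..m}" "k \<noteq> l"
    show "\<alpha> - \<beta> * cos (2 * pi / real m) \<le> gform K (p k) (p l)"
      using cos_cyclic(1)[OF kl assms(2)] ab(1) f[OF kl(1,2)] by simp
    show "gform K (p k) (p l) = \<alpha> - \<beta> * cos (2 * pi / real m) \<longleftrightarrow> cyc_adjacent m k l"
      using cos_cyclic(2)[OF kl assms(2)] ab(1) f[OF kl(1,2)] by simp
  next
    show "inj_on p {1..m}"
    proof (rule inj_onI, rule ccontr)
      fix k l assume kl: "k \<in> {1..m}" "l \<in> {1..m}" "p k = p l" "k \<noteq> l"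
      have "gform K (p k) (p l) = gform K (p k) (p k)" using kl by simp
      then have "cos (2 * pi * (real k - real l) / real m) = 1"
        using f[OF kl(1,2)] f[OF kl(1,1)] ab(1) by simp
      then show False using cos_cyclic(1)[OF kl(1,2,4) assms(2)] cos_cyclic_less_1[OF assms(2)] by simp
    qed
  qed
qed

lemma regular_polygon_inj:
  assumes "regular_polygon K m p" "3 \<le> m"
  shows "inj_on p {1..m}"
  by (rule regular_polygon_gform[OF assms])

lemma cyc_succ_neq:
  assumes "k \<in> {1..m}" "3 \<le> m"
  shows "cyc_succ m k \<noteq> k"
  unfolding cyc_succ_def using assms by (cases "k = m") simp_all

lemma cyc_succ_succ_neq:
  assumes "k \<in> {1..m}" "3 \<le> m"
  shows "cyc_succ m (cyc_succ m k) \<noteq> k"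
  unfolding cyc_succ_def using assms by (cases "k = m"; cases "Suc k = m") simp_all

lemma cyc_succ_inj: "k \<in> {1..m} \<Longrightarrow> l \<in> {1..m} \<Longrightarrow> cyc_succ m k = cyc_succ m l \<Longrightarrow> k = l"
  unfolding cyc_succ_def by (cases "k = m"; cases "l = m") simp_all

lemma cyc_succ_less: "k < m \<Longrightarrow> cyc_succ m k = Suc k"
  by (simp add: cyc_succ_def)

lemma cyc_succ_last: "cyc_succ m m = 1"
  by (simp add: cyc_succ_def)

text \<open>The least values \<open>c\<close> and \<open>d\<close> of the two numberings coincide,
  being minima over the same pairs of points; a pair attaining them is adjacent in either
  numbering.\<close>

lemma same_vertices_adjacent:
  assumes reg: "regular_polygon K m p" "regular_polygon K m q" "3 \<le> m"
    and img: "q ` {1..m} = p ` {1..m}"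
    and k: "k \<in> {1..m}" "l \<in> {1..m}" "k' \<in> {1..m}" "l' \<in> {1..m}" "q k = p k'" "q l = p l'"
    and adj: "cyc_adjacent m k l"
  shows "cyc_adjacent m k' l'"
proof -
  obtain c where c: "\<And>k l. k \<in> {1..m} \<Longrightarrow> l \<in> {1..m} \<Longrightarrow> k \<noteq> l \<Longrightarrow> c \<le> gform K (p k) (p l)"
    "\<And>k l. k \<in> {1..m} \<Longrightarrow> l \<in> {1..m} \<Longrightarrow> k \<noteq> l \<Longrightarrow> gform K (p k) (p l) = c \<longleftrightarrow> cyc_adjacent m k l"
    "inj_on p {1..m}"
    by (fact regular_polygon_gform[OF reg(1,3)])
  obtain d where d: "\<And>k l. k \<in> {1..m} \<Longrightarrow> l \<in> {1..m} \<Longrightarrow> k \<noteq> l \<Longrightarrow> d \<le> gform K (q k) (q l)"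
    "\<And>k l. k \<in> {1..m} \<Longrightarrow> l \<in> {1..m} \<Longrightarrow> k \<noteq> l \<Longrightarrow> gform K (q k) (q l) = d \<longleftrightarrow> cyc_adjacent m k l"
    "inj_on q {1..m}"
    by (fact regular_polygon_gform[OF reg(2,3)])
  have "cyc_succ m 1 = 2"
    unfolding cyc_succ_def using \<open>3 \<le> m\<close> by simp
  then have adj12: "cyc_adjacent m 1 2" unfolding cyc_adjacent_def by simp
  have 1: "1 \<in> {1..m}" "2 \<in> {1..m}" "cyc_adjacent m 1 2" "(1::nat) \<noteq> 2"
    using \<open>3 \<le> m\<close> adj12 by simp_all
  have "p 1 \<in> q ` {1..m}" "p 2 \<in> q ` {1..m}" unfolding img using 1(1,2) by simp_all
  then obtain u v where u: "u \<in> {1..m}" "v \<in> {1..m}" "p 1 = q u" "p 2 = q v"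
    by (elim imageE)
  have "d \<le> c"
  proof -
    have "u \<noteq> v" using inj_onD[OF c(3), of 1 2] 1 u by auto
    then show ?thesis using d(1)[OF u(1,2)] c(2)[OF 1(1,2,4)] 1(3) u by simp
  qed
  moreover have "k \<noteq> l"
    using adj cyc_succ_neq[OF k(1) \<open>3 \<le> m\<close>] by (cases "k = l") (simp_all add: cyc_adjacent_def)
  then have kl': "k' \<noteq> l'" using inj_onD[OF d(3), of k l] k by auto
  moreover have "gform K (p k') (p l') = d"
    using d(2)[OF k(1,2) \<open>k \<noteq> l\<close>] adj k by simp
  ultimately have "gform K (p k') (p l') = c" using c(1)[OF k(3,4) kl'] by simp
  then show ?thesis using c(2)[OF k(3,4) kl'] by simp
qed

text \<open>Climb from \<open>j\<close> to \<open>m\<close>, wrap round to 1, and climb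
  again.\<close>

lemma cyclic_induct:
  assumes "j \<in> {1..m}" "P j" "\<And>k. k \<in> {1..m} \<Longrightarrow> P k \<Longrightarrow> P (cyc_succ m k)" "k \<in> {1..m}"
  shows "P k"
proof -
  have up: "P l" if "i \<le> l" "l \<le> m" "P i" "1 \<le> i" for i l
    using that
  proof (induction l rule: dec_induct)
    case (step l)
    then show ?case using assms(3)[of l] by (simp add: cyc_succ_less)
  qed simp
  have "P m" using up[of j m] assms(1,2) by simp
  then have "P 1" using assms(3)[of m] assms(1) by (simp add: cyc_succ_last)
  then show ?thesis using up[of 1 k] assms(4) by simp
qed

text \<open>Given agreement at \<open>k\<close> and its successor, the next corner is a neighbour of
  the latter other than the former, so only one choice is left. One corner alone would still allow
  the reversed order.\<close>

lemma same_vertices_agree: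
  assumes reg: "regular_polygon K m p" "regular_polygon K m q" "3 \<le> m"
    and img: "q ` {1..m} = p ` {1..m}"
    and j: "j \<in> {1..m}" "q j = p j" "q (cyc_succ m j) = p (cyc_succ m j)"
    and k: "k \<in> {1..m}"
  shows "q k = p k"
proof -
  have inj: "inj_on q {1..m}" using regular_polygon_inj reg by blast
  have "q k = p k \<and> q (cyc_succ m k) = p (cyc_succ m k)"
  proof (rule cyclic_induct[where P = "\<lambda>k. q k = p k \<and> q (cyc_succ m k) = p (cyc_succ m k)", OF j(1)])
    fix k assume k: "k \<in> {1..m}" and IH: "q k = p k \<and> q (cyc_succ m k) = p (cyc_succ m k)"
    define k1 where "k1 = cyc_succ m k"
    define k2 where "k2 = cyc_succ m k1"
    have in12: "k1 \<in> {1..m}" "k2 \<in> {1..m}" using k cyc_succ_in by (auto simp: k1_def k2_def)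
    have "q k2 \<in> p ` {1..m}" using img in12 by blast
    then obtain l where l: "l \<in> {1..m}" "q k2 = p l" by blast
    have "cyc_adjacent m k1 l"
      using same_vertices_adjacent[OF reg img in12(1,2,1) l(1) _ l(2)] IH
      by (simp add: k1_def k2_def cyc_adjacent_def)
    moreover have "l \<noteq> k"
      using l(2) IH cyc_succ_succ_neq[OF k reg(3)] inj_onD[OF inj, of k2 k] in12 k
      by (auto simp: k1_def k2_def)
    ultimately have "l = k2"
      using cyc_succ_inj[OF l(1) k] by (auto simp: cyc_adjacent_def k1_def k2_def)
    then show "q (cyc_succ m k) = p (cyc_succ m k) \<and>
        q (cyc_succ m (cyc_succ m k)) = p (cyc_succ m (cyc_succ m k))"
      using IH l by (simp add: k1_def k2_def)
  qed (use j k in auto)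
  then show ?thesis by blast
qed

section \<open>Corners as extreme rays of the spanned cone\<close>

text \<open>Sign and face membership are put into the single set \<open>?P\<close>, which is a
  convex cone: a sum of nonnegative values vanishes only if both do.\<close>

lemma convex_cone_hull_face:
  assumes lin: "linear f" and pos: "\<And>s. s \<in> S \<Longrightarrow> 0 \<le> (f s :: real)"
    and x: "x \<in> convex_cone hull S"
  shows "0 \<le> f x" "f x = 0 \<Longrightarrow> x \<in> convex_cone hull {s \<in> S. f s = 0}"
proof -
  let ?H = "convex_cone hull {s \<in> S. f s = 0}"
  let ?P = "{x. 0 \<le> f x \<and> (f x = 0 \<longrightarrow> x \<in> ?H)}"
  have "convex_cone ?P"
  proof (rule convex_cone_iff[THEN iffD2], intro conjI ballI allI impI)
    show "0 \<in> ?P" by (simp add: linear_0[OF lin] convex_cone_hull_contains_0)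
    show "x + y \<in> ?P" if "x \<in> ?P" "y \<in> ?P" for x y
      using that convex_cone_hull_add[of x _ y]
      by (auto simp: linear_add[OF lin] add_nonneg_eq_0_iff)
    show "c *\<^sub>R x \<in> ?P" if "x \<in> ?P" "0 \<le> c" for x c
      using that convex_cone_hull_mul[of x _ c]
      by (auto simp: linear_scale[OF lin] convex_cone_hull_contains_0)
  qed
  moreover have "S \<subseteq> ?P" using pos by (auto intro: hull_inc)
  ultimately have "convex_cone hull S \<subseteq> ?P" by (simp add: hull_minimal)
  then show "0 \<le> f x" "f x = 0 \<Longrightarrow> x \<in> ?H" using x by auto
qed

text \<open>The functional is pulled back from one whose zero set meets the plane of the model
  circle in the tangent at corner \<open>k\<close>; the other corners lie strictly on one side of
  that tangent.\<close>

lemma regular_polygon_support: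
  assumes "regular_polygon K m p" "3 \<le> m" "k \<in> {1..m}"
  obtains f :: "point \<Rightarrow> real" where "linear f" "f (p k) = 0"
    "\<And>l. l \<in> {1..m} \<Longrightarrow> l \<noteq> k \<Longrightarrow> 0 < f (p l)"
proof -
  obtain a b h where h: "0 < a" "0 < b" "isometry K h"
    and s: "\<And>k. k \<in> {1..m} \<Longrightarrow> circle_point m a b k \<in> surface K"
    and p: "\<And>k. k \<in> {1..m} \<Longrightarrow> p k = h (circle_point m a b k)"
    by (fact regular_polygonE[OF assms(1)])
  obtain h' where h': "isometry K h'" "\<And>x. x \<in> surface K \<Longrightarrow> h' (h x) = x"
    "\<And>x. x \<in> surface K \<Longrightarrow> h (h' x) = x"
    by (fact isometry_inverse[OF h(3)])
  obtain M where M: "linear M" "\<And>x. x \<in> surface K \<Longrightarrow> h' x = M x"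
    by (fact isometry_linear[OF h'(1)])
  let ?c = "circle_point m a b k"
  \<comment> \<open>At height \<open>b\<close> the first term is the squared radius, which the
    scalar product with corner \<open>k\<close> reaches on the circle only at that corner.\<close>
  define e where "e x = a\<^sup>2 / b * x $ 3 - (?c $ 1 * x $ 1 + ?c $ 2 * x $ 2)" for x :: point
  have lin: "linear e" by (rule linearI) (auto simp: e_def algebra_simps)
  have Mp: "M (p l) = circle_point m a b l" if "l \<in> {1..m}" for l
    using h'(2)[OF s[OF that]] M(2)[OF isometry_in[OF h(3) s[OF that]]] p[OF that] by simp
  have e: "e (circle_point m a b l) = a\<^sup>2 * (1 - cos (2 * pi * (real k - real l) / real m))" for l
    using h(2) by (simp add: e_def circle_point_def cos_diff right_diff_distrib diff_divide_distrib
        power2_eq_square algebra_simps)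
  show thesis
  proof (rule that[of "e \<circ> M"])
    show "linear (e \<circ> M)" using linear_compose[OF M(1) lin] .
    show "(e \<circ> M) (p k) = 0" using Mp[OF assms(3)] e[of k] by simp
    show "0 < (e \<circ> M) (p l)" if "l \<in> {1..m}" "l \<noteq> k" for l
      using Mp[OF that(1)] e[of l] h(1) cos_cyclic(1)[OF assms(3) that(1) that(2)[symmetric] assms(2)]
        cos_cyclic_less_1[OF assms(2)] by simp
  qed
qed

text \<open>The support functional at \<open>p k\<close> is nonnegative on the cone, which contains
  every \<open>q l\<close>. As \<open>p k\<close> itself lies in the cone of the \<open>q l\<close>,
  some \<open>q l\<close> must lie in the zero face, and that face is the ray of
  \<open>p k\<close>.\<close>

lemma ghull_vertices_subset:
  assumes reg: "regular_polygon K m p" "regular_polygon K m q" "3 \<le> m"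
    and hull: "ghull K (p ` {1..m}) = ghull K (q ` {1..m})"
  shows "p ` {1..m} \<subseteq> q ` {1..m}"
proof
  fix x assume "x \<in> p ` {1..m}"
  then obtain k where k: "k \<in> {1..m}" "x = p k" by blast
  obtain f :: "point \<Rightarrow> real" where f: "linear f" "f (p k) = 0"
    "\<And>l. l \<in> {1..m} \<Longrightarrow> l \<noteq> k \<Longrightarrow> 0 < f (p l)"
    by (fact regular_polygon_support[OF reg(1,3) k(1)])
  have fp: "0 \<le> f s" if s: "s \<in> p ` {1..m}" for s
  proof -
    obtain l where "l \<in> {1..m}" "s = p l" using s by (elim imageE)
    then show ?thesis using f(2) f(3)[of l] by (cases "l = k") auto
  qed
  have zero: "{s \<in> p ` {1..m}. f s = 0} = {x}" using f k by (force simp: less_le)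
  have qc: "q l \<in> convex_cone hull (p ` {1..m})" if "l \<in> {1..m}" for l
    using ghull_inc[of "q l" "q ` {1..m}" K] regular_polygon_in[OF reg(2) that] that hull
    by (auto simp: ghull_def)
  have fq: "0 \<le> f s" if "s \<in> q ` {1..m}" for s
    using that convex_cone_hull_face(1)[OF f(1) fp qc] by auto
  have xs: "x \<in> surface K" using regular_polygon_in[OF reg(1)] k by simp
  then have "x \<in> ghull K (q ` {1..m})" using ghull_inc[of x "p ` {1..m}"] k hull by auto
  then have "x \<in> convex_cone hull {s \<in> q ` {1..m}. f s = 0}"
    using convex_cone_hull_face(2)[OF f(1) fq] f(2) k(2) by (auto simp: ghull_def)
  moreover have "x \<noteq> 0" using xs surface_0 by metis
  ultimately have "{s \<in> q ` {1..m}. f s = 0} \<noteq> {}" by (metis convex_cone_hull_empty singletonD)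
  then obtain l where l: "l \<in> {1..m}" "f (q l) = 0" by blast
  have "q l \<in> convex_cone hull {x}"
    using convex_cone_hull_face(2)[OF f(1) fp qc[OF l(1)] l(2)] zero by simp
  moreover have ql: "q l \<noteq> 0" using regular_polygon_in[OF reg(2) l(1)] surface_0 by metis
  ultimately obtain c where "0 \<le> c" "q l = c *\<^sub>R x"
    using ql by (auto simp: convex_cone_hull_separate conic_hull_as_image)
  then have "q l = x"
    using surface_ray_unique[OF xs, of c] regular_polygon_in[OF reg(2) l(1)] by simp
  then show "x \<in> q ` {1..m}" using l(1) by blast
qed

lemma polygon_region_vertices:
  assumes "polygon_region K m p F" "polygon_region K m q F" "3 \<le> m"
  shows "q ` {1..m} = p ` {1..m}"
  using assms ghull_vertices_subset[of K m p q] ghull_vertices_subset[of K m q p]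
  by (auto simp: polygon_region_def)

lemma polygon_region_agree:
  assumes "polygon_region K m p F" "polygon_region K m q F" "3 \<le> m"
    and "j \<in> {1..m}" "q j = p j" "q (cyc_succ m j) = p (cyc_succ m j)" "k \<in> {1..m}"
  shows "q k = p k"
  using same_vertices_agree[of K m p q j k] polygon_region_vertices[OF assms(1,2,3)] assms
  by (simp add: polygon_region_def)

text \<open>Sides are compared as unordered pairs, since \<open>q\<close> may run round the polygon
  in the opposite sense to \<open>p\<close>.\<close>

lemma polygon_region_side:
  assumes "polygon_region K m p F" "polygon_region K m q F" "3 \<le> m" "k \<in> {1..m}"
  obtains l where "l \<in> {1..m}" "{q k, q (cyc_succ m k)} = {p l, p (cyc_succ m l)}"
proof -
  have img: "q ` {1..m} = p ` {1..m}" using polygon_region_vertices assms by blast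
  have reg: "regular_polygon K m p" "regular_polygon K m q"
    using assms(1,2) by (auto simp: polygon_region_def)
  have k1: "cyc_succ m k \<in> {1..m}" using assms(4) by (rule cyc_succ_in)
  have "q k \<in> p ` {1..m}" "q (cyc_succ m k) \<in> p ` {1..m}"
    unfolding img[symmetric] using assms(4) k1 by simp_all
  then obtain u v where u: "u \<in> {1..m}" "q k = p u" and v: "v \<in> {1..m}" "q (cyc_succ m k) = p v"
    by (elim imageE)
  have "cyc_adjacent m u v"
    by (rule same_vertices_adjacent[OF reg assms(3) img assms(4) k1 u(1) v(1) u(2) v(2)])
      (simp add: cyc_adjacent_def)
  then show thesis
    unfolding cyc_adjacent_def
  proof
    assume "v = cyc_succ m u"
    then show thesis by (intro that[OF u(1)]) (simp add: u(2) v(2))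
  next
    assume "u = cyc_succ m v"
    then show thesis by (intro that[OF v(1)]) (simp add: u(2) v(2) insert_commute)
  qed
qed

section \<open>Rigidity: an isometry is determined by the corners of one polygon\<close>

lemma span_circle_point:
  assumes "3 \<le> m" "0 < a" "0 < b"
  shows "span (circle_point m a b ` {1..m}) = UNIV"
proof -
  let ?S = "span (circle_point m a b ` {1..m})"
  define t where "t = 2 * pi / real m"
  have t: "0 < t" "t < pi" using assms by (auto simp: t_def field_simps)
  have "cos t < cos 0" using t by (intro cos_monotone_0_pi) auto
  then have ct: "cos t - 1 \<noteq> 0" by simp
  have st: "sin t \<noteq> 0" using sin_gt_zero[OF t] by simp
  \<comment> \<open>Corners 1 and \<open>m - 1\<close> sit at angles \<open>t\<close> and
    \<open>- t\<close>, corner \<open>m\<close> at angle 0: the difference of the first two isolates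
    the second axis, their sum minus twice corner \<open>m\<close> the first.\<close>
  define u v w where "u = circle_point m a b 1" and "v = circle_point m a b (m - 1)"
    and "w = circle_point m a b m"
  have uvw: "u \<in> ?S" "v \<in> ?S" "w \<in> ?S"
    using assms by (auto simp: u_def v_def w_def intro!: span_base)
  have ang: "2 * pi * real (m - 1) / real m = 2 * pi - t" "2 * pi * real m / real m = 2 * pi"
    using assms(1) by (simp_all add: t_def of_nat_diff right_diff_distrib diff_divide_distrib)
  have cu: "u $ 1 = a * cos t" "u $ 2 = a * sin t" "u $ 3 = b"
    and cv: "v $ 1 = a * cos t" "v $ 2 = - a * sin t" "v $ 3 = b"
    and cw: "w $ 1 = a" "w $ 2 = 0" "w $ 3 = b"
    unfolding u_def v_def w_def circle_point_def ang
    using assms by (auto simp: t_def cos_diff sin_diff)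
  have e2: "axis 2 1 \<in> ?S"
  proof -
    have "axis 2 1 = (1 / (2 * a * sin t)) *\<^sub>R (u - v)"
      using assms st by (simp add: vec_eq_iff forall_3 axis_def cu cv)
    then show ?thesis using uvw by (simp add: span_mul span_diff)
  qed
  have e1: "axis 1 1 \<in> ?S"
  proof -
    have "axis 1 1 = (1 / (2 * a * (cos t - 1))) *\<^sub>R (u + v - 2 *\<^sub>R w)"
      using assms ct by (simp add: vec_eq_iff forall_3 axis_def cu cv cw) (simp add: field_simps)
    then show ?thesis using uvw by (simp add: span_mul span_diff span_add)
  qed
  have e3: "axis 3 1 \<in> ?S"
  proof -
    have "axis 3 1 = (1 / b) *\<^sub>R (w - a *\<^sub>R axis 1 1)"
      using assms by (simp add: vec_eq_iff forall_3 axis_def cw)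
    then show ?thesis using uvw e1 by (simp add: span_mul span_diff)
  qed
  have "x \<in> ?S" for x :: point
  proof -
    have "x = x $ 1 *\<^sub>R axis 1 1 + x $ 2 *\<^sub>R axis 2 1 + x $ 3 *\<^sub>R axis 3 1"
      by (simp add: vec_eq_iff forall_3 axis_def)
    then show ?thesis using e1 e2 e3 by (metis span_add span_mul)
  qed
  then show ?thesis by blast
qed

text \<open>The linear extensions of \<open>g \<circ> h\<close> and \<open>h\<close> agree at the
  corners of the model polygon, and these span the whole space. This prevents a reflection from
  fixing all corners of a tile.\<close>

lemma isometry_fixing_polygon:
  assumes "isometry K g" "regular_polygon K m p" "3 \<le> m"
    and fix_p: "\<And>k. k \<in> {1..m} \<Longrightarrow> g (p k) = p k" and x: "x \<in> surface K"
  shows "g x = x"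
proof -
  obtain a b h where h: "0 < a" "0 < b" "isometry K h"
    and s: "\<And>k. k \<in> {1..m} \<Longrightarrow> circle_point m a b k \<in> surface K"
    and p: "\<And>k. k \<in> {1..m} \<Longrightarrow> p k = h (circle_point m a b k)"
    by (fact regular_polygonE[OF assms(2)])
  obtain L where L: "linear L" "\<And>x. x \<in> surface K \<Longrightarrow> (g \<circ> h) x = L x"
    by (fact isometry_linear[OF isometry_comp[OF assms(1) h(3)]])
  obtain M where M: "linear M" "\<And>x. x \<in> surface K \<Longrightarrow> h x = M x"
    by (fact isometry_linear[OF h(3)])
  have "L y = M y" for y
  proof (rule linear_eq_on[OF L(1) M(1)])
    show "y \<in> span (circle_point m a b ` {1..m})" using span_circle_point assms(3) h by blast
    show "L c = M c" if c: "c \<in> circle_point m a b ` {1..m}" for c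
    proof -
      obtain k where "k \<in> {1..m}" "c = circle_point m a b k" using c by (elim imageE)
      then show ?thesis using fix_p[of k] p[of k] L(2)[OF s[of k]] M(2)[OF s[of k]] by simp
    qed
  qed
  moreover have "x \<in> h ` surface K" using x h(3) by (simp add: isometry_def bij_betw_def)
  then obtain y where "y \<in> surface K" "x = h y" by (elim imageE)
  ultimately show ?thesis using L(2)[of y] M(2)[of y] by simp
qed

section \<open>Gallery connectedness of tilings\<close>

lemma connected_image_diff_countable:
  fixes f :: "'a::euclidean_space \<Rightarrow> 'b::topological_space"
  assumes "convex P" "\<not> collinear P" "continuous_on P f" "inj_on f P" "countable V"
  shows "connected (f ` P - V)"
proof -
  let ?W = "{x \<in> P. f x \<in> V}"
  have "inj_on f ?W" using assms(4) by (rule inj_on_subset) auto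
  moreover have "countable (f ` ?W)" using assms(5) by (rule countable_subset[rotated]) auto
  ultimately have "countable ?W" by (rule countable_image_inj_on[rotated])
  then have "connected (P - ?W)" by (rule connected_convex_diff_countable[OF assms(1,2)])
  then have "connected (f ` (P - ?W))"
    by (rule connected_continuous_image[rotated]) (rule continuous_on_subset[OF assms(3)], auto)
  moreover have "f ` (P - ?W) = f ` P - V" by auto
  ultimately show ?thesis by simp
qed

lemma surface_Euclidean_hyperplane: "surface Euclidean = {x. axis 3 1 \<bullet> x = 1}"
  by (simp add: inner_axis')

lemma convex_surface_Euclidean: "convex (surface Euclidean)"
  unfolding surface_Euclidean_hyperplane by (rule convex_hyperplane)

lemma not_collinear_surface_Euclidean: "\<not> collinear (surface Euclidean)"
proof -
  have "aff_dim (surface Euclidean) = 2"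
    unfolding surface_Euclidean_hyperplane by (simp add: axis_eq_0_iff)
  then show ?thesis unfolding collinear_aff_dim by simp
qed

text \<open>Each surface is an injective continuous image of the plane, up to one point of the
  sphere, and in the plane deleting countably many points preserves connectedness. The hyperboloid
  is reached by moving points vertically.\<close>

lemma connected_surface_diff_countable:
  assumes "countable V"
  shows "connected (surface K - V)"
proof (cases K)
  case Euclidean
  then show ?thesis
    using connected_convex_diff_countable convex_surface_Euclidean
      not_collinear_surface_Euclidean assms by blast
next
  case Hyperbolic
  define f :: "point \<Rightarrow> point" where
    "f x = x + (sqrt (1 + (x$1)\<^sup>2 + (x$2)\<^sup>2) - x$3) *\<^sub>R axis 3 1" for x
  have f: "f x $ 1 = x $ 1" "f x $ 2 = x $ 2" "f x $ 3 = sqrt (1 + (x$1)\<^sup>2 + (x$2)\<^sup>2)" for x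
    by (simp_all add: f_def axis_def)
  have img: "f ` surface Euclidean = surface Hyperbolic"
  proof (intro equalityI subsetI)
    fix y assume "y \<in> f ` surface Euclidean"
    then obtain x where y: "y = f x" by blast
    have "0 < 1 + (x$1)\<^sup>2 + (x$2)\<^sup>2" by (simp add: add_pos_nonneg)
    then show "y \<in> surface Hyperbolic"
      by (simp add: y lorentz_def f flip: power2_eq_square)
  next
    fix y assume y: "y \<in> surface Hyperbolic"
    define x where "x = y + (1 - y$3) *\<^sub>R axis 3 (1::real)"
    have x: "x $ 1 = y $ 1" "x $ 2 = y $ 2" "x $ 3 = 1" by (simp_all add: x_def axis_def)
    have "(y$3)\<^sup>2 = 1 + (y$1)\<^sup>2 + (y$2)\<^sup>2" "0 < y$3"
      using y by (auto simp: lorentz_def power2_eq_square)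
    then have "sqrt (1 + (y$1)\<^sup>2 + (y$2)\<^sup>2) = y$3" by (metis less_le real_sqrt_unique)
    then have "y = f x" by (simp add: vec_eq_iff forall_3 f x)
    then show "y \<in> f ` surface Euclidean" using x by simp
  qed
  have "continuous_on (surface Euclidean) f"
    unfolding f_def by (intro continuous_intros)
  moreover have "inj_on f (surface Euclidean)"
  proof (rule inj_onI)
    fix x y assume "x \<in> surface Euclidean" "y \<in> surface Euclidean" "f x = f y"
    then show "x = y" using f[of x] f[of y] by (simp add: vec_eq_iff forall_3)
  qed
  ultimately have "connected (f ` surface Euclidean - V)"
    using connected_image_diff_countable convex_surface_Euclidean
      not_collinear_surface_Euclidean assms by blast
  then show ?thesis using img Hyperbolic by simp
next
  case Spherical
  have S: "surface K = sphere 0 1" using Spherical by (auto simp: dist_norm)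
  show ?thesis
  proof (cases "V \<inter> surface K = {}")
    case True
    then have "surface K - V = sphere 0 1" using S by auto
    then show ?thesis using connected_sphere[of "0::point" 1] by simp
  next
    case False
    \<comment> \<open>The sphere needs a puncture before it becomes a plane; taking it inside
      \<open>V\<close> removes no point that was to be kept.\<close>
    then obtain b where b: "b \<in> V" "b \<in> sphere 0 1" using S by auto
    have "(sphere 0 1 - {b}) homeomorphic {x::point. axis 3 1 \<bullet> x = 1}"
      by (rule homeomorphic_punctured_sphere_hyperplane) (use b in \<open>auto simp: axis_eq_0_iff\<close>)
    then obtain f g where h: "homeomorphism (surface Euclidean) (sphere 0 1 - {b}) g f"
      unfolding surface_Euclidean_hyperplane homeomorphic_def using homeomorphism_symD by blast
    have "inj_on g (surface Euclidean)"
      by (rule inj_on_inverseI[where g = f]) (use h in \<open>simp add: homeomorphism_def\<close>)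
    then have "connected (g ` surface Euclidean - V)"
      using connected_image_diff_countable convex_surface_Euclidean
        not_collinear_surface_Euclidean assms h by (meson homeomorphism_cont1)
    moreover have "g ` surface Euclidean - V = surface K - V"
      using homeomorphism_image1[OF h] b S by auto
    ultimately show ?thesis by simp
  qed
qed

section \<open>Closedness of the surfaces and size of the polygons\<close>

lemma closed_surface: "closed (surface K)"
proof (cases K)
  case Spherical
  have "surface K = sphere 0 1" using Spherical by (auto simp: dist_norm)
  then show ?thesis by simp
next
  case Euclidean
  then show ?thesis using surface_Euclidean_hyperplane closed_hyperplane by simp
next
  case Hyperbolic
  \<comment> \<open>The strict inequality can be relaxed because the form is nonnegative at height
    0.\<close>
  have "surface K = {x. lorentz x x = - 1} \<inter> {x. 0 \<le> x$3}"
  proof -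
    have False if "lorentz x x = - 1" "x$3 = 0" for x
    proof -
      have "lorentz x x = x$1 * x$1 + x$2 * x$2" using that(2) by (simp add: lorentz_def)
      moreover have "0 \<le> x$1 * x$1 + x$2 * x$2" by simp
      ultimately show False using that(1) by simp
    qed
    then show ?thesis using Hyperbolic by (auto simp: less_le)
  qed
  moreover have "closed {x. lorentz x x = - 1}"
    unfolding lorentz_def by (intro closed_Collect_eq continuous_intros)
  moreover have "closed {x::point. 0 \<le> x$3}"
    by (intro closed_Collect_le continuous_intros)
  ultimately show ?thesis by auto
qed

text \<open>Radial projection of a chord. On the hyperboloid \<open>lorentz_le_minus_1\<close> keeps
  the form at most \<open>- 1\<close> along the chord, so a square root can be divided out.\<close>

lemma surface_scale:
  assumes "x \<in> surface K" "y \<in> surface K" "0 < x$3" "0 < y$3" "0 \<le> t" "t \<le> 1"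
  obtains r where "0 < r" "r *\<^sub>R ((1 - t) *\<^sub>R x + t *\<^sub>R y) \<in> surface K"
proof -
  define z where "z = (1 - t) *\<^sub>R x + t *\<^sub>R y"
  have z3: "0 < z$3"
  proof (cases "t = 1")
    case False
    then have "0 < (1 - t) * x$3" "0 \<le> t * y$3" using assms by auto
    then show ?thesis by (simp add: z_def)
  qed (use assms in \<open>simp add: z_def\<close>)
  show thesis
  proof (cases K)
    case Spherical
    have "z \<noteq> 0" using z3 by auto
    then show thesis by (intro that[of "1 / norm z"]) (simp_all add: Spherical flip: z_def)
  next
    case Euclidean
    then show thesis using z3 by (intro that[of "1 / z$3"]) (simp_all flip: z_def)
  next
    case Hyperbolic
    have "lorentz z z = (1 - t)\<^sup>2 * lorentz x x + t\<^sup>2 * lorentz y y + 2 * t * (1 - t) * lorentz x y"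
      by (simp add: z_def lorentz_def power2_eq_square algebra_simps)
    also have "lorentz x x = - 1" using assms Hyperbolic by simp
    also have "lorentz y y = - 1" using assms Hyperbolic by simp
    also have "(1 - t)\<^sup>2 * - 1 + t\<^sup>2 * - 1 + 2 * t * (1 - t) * lorentz x y \<le>
        (1 - t)\<^sup>2 * - 1 + t\<^sup>2 * - 1 + 2 * t * (1 - t) * - 1"
      using lorentz_le_minus_1[of x y] assms Hyperbolic by (intro add_left_mono mult_left_mono) auto
    also have "\<dots> = - 1" by (simp add: power2_eq_square algebra_simps)
    finally have l: "lorentz z z < 0" by simp
    define r where "r = 1 / sqrt (- lorentz z z)"
    have "lorentz (r *\<^sub>R z) (r *\<^sub>R z) = r\<^sup>2 * lorentz z z"
      by (simp add: lorentz_def power2_eq_square algebra_simps)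
    also have "\<dots> = - 1" using l by (simp add: r_def power_divide)
    finally show thesis using l z3
      by (intro that[of r]) (simp_all add: Hyperbolic r_def flip: z_def)
  qed
qed

text \<open>One side already suffices: the chord between corners 1 and 2 is projected injectively.
  The purpose is that deleting countably many corners never empties a tile.\<close>

lemma uncountable_polygon_region:
  assumes "polygon_region K m p F" "3 \<le> m"
  shows "uncountable F"
proof -
  have reg: "regular_polygon K m p" and F: "F = ghull K (p ` {1..m})"
    using assms by (auto simp: polygon_region_def)
  obtain a b h where h: "0 < a" "0 < b" "isometry K h"
    and s: "\<And>k. k \<in> {1..m} \<Longrightarrow> circle_point m a b k \<in> surface K"
    and p: "\<And>k. k \<in> {1..m} \<Longrightarrow> p k = h (circle_point m a b k)"
    by (fact regular_polygonE[OF reg])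
  define c where "c = circle_point m a b"
  have in12: "1 \<in> {1..m}" "2 \<in> {1..m}" using \<open>3 \<le> m\<close> by auto
  have cs: "c 1 \<in> surface K" "c 2 \<in> surface K" using s in12 by (auto simp: c_def)
  have c3: "c k $ 3 = b" for k by (simp add: c_def circle_point_def)
  have ne: "c 1 \<noteq> c 2"
    using inj_onD[OF regular_polygon_inj[OF reg assms(2)], of 1 2] in12 p[OF in12(1)] p[OF in12(2)]
    by (auto simp: c_def)
  have "\<exists>r>0. r *\<^sub>R ((1 - t) *\<^sub>R c 1 + t *\<^sub>R c 2) \<in> surface K" if t: "t \<in> {0<..<1}" for t
    by (rule surface_scale[OF cs, of t]) (use t h c3 in auto)
  then obtain r where r: "\<And>t. t \<in> {0<..<1} \<Longrightarrow> 0 < r t"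
    "\<And>t. t \<in> {0<..<1} \<Longrightarrow> r t *\<^sub>R ((1 - t) *\<^sub>R c 1 + t *\<^sub>R c 2) \<in> surface K"
    by metis
  define q where "q t = r t *\<^sub>R ((1 - t) *\<^sub>R c 1 + t *\<^sub>R c 2)" for t
  have "inj_on q {0<..<1}"
  proof (rule inj_onI)
    fix t u assume tu: "t \<in> {0<..<1}" "u \<in> {0<..<1}" "q t = q u"
    \<comment> \<open>The chord stays at height \<open>b\<close>, so the third coordinate reveals
      the scaling factor.\<close>
    have q3: "q t $ 3 = r t * b" for t by (simp add: q_def c3 algebra_simps)
    then have "r t = r u" using q3[of t] q3[of u] tu(3) h by simp
    then have "(1 - t) *\<^sub>R c 1 + t *\<^sub>R c 2 = (1 - u) *\<^sub>R c 1 + u *\<^sub>R c 2"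
      using tu r(1)[OF tu(1)] by (simp add: q_def)
    then have "(t - u) *\<^sub>R (c 2 - c 1) = 0" by (simp add: algebra_simps)
    then show "t = u" using ne by simp
  qed
  moreover have "uncountable {0<..<1::real}" by (simp add: uncountable_open_interval)
  ultimately have "uncountable (q ` {0<..<1})" using countable_image_inj_on by blast
  moreover have "q t \<in> ghull K (c ` {1..m})" if "t \<in> {0<..<1}" for t
  proof -
    have "c 1 \<in> convex_cone hull (c ` {1..m})" "c 2 \<in> convex_cone hull (c ` {1..m})"
      using in12 by (auto intro!: hull_inc)
    then have "q t \<in> convex_cone hull (c ` {1..m})"
      unfolding q_def using that r(1)[OF that]
      by (intro convex_cone_hull_mul convex_cone_hull_add) auto
    then show ?thesis using r(2)[OF that] by (simp add: ghull_def q_def)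
  qed
  then have "q ` {0<..<1} \<subseteq> ghull K (c ` {1..m})" by blast
  ultimately have unc: "uncountable (ghull K (c ` {1..m}))" using countable_subset by blast
  have "inj_on h (ghull K (c ` {1..m}))"
    using h(3) ghull_subset_surface unfolding isometry_def bij_betw_def by (blast intro: inj_on_subset)
  then have "uncountable (h ` ghull K (c ` {1..m}))" using unc countable_image_inj_on by blast
  moreover have "h ` ghull K (c ` {1..m}) = ghull K (h ` c ` {1..m})"
    by (rule isometry_ghull[OF h(3)]) (use s in \<open>auto simp: c_def\<close>)
  moreover have "h ` c ` {1..m} = p ` {1..m}"
    unfolding image_image by (rule image_cong) (simp_all add: p c_def)
  ultimately show ?thesis using F by simp
qed

lemma corners_of_eq:
  assumes "polygon_region K m p F" "3 \<le> m"
  shows "corners_of K m F = p ` {1..m}"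
proof (intro equalityI subsetI)
  fix x assume "x \<in> corners_of K m F"
  then obtain q k where q: "polygon_region K m q F" "k \<in> {1..m}" "x = q k"
    unfolding corners_of_def by blast
  have "q ` {1..m} = p ` {1..m}" using polygon_region_vertices[OF assms(1) q(1) assms(2)] .
  then show "x \<in> p ` {1..m}" using q by blast
next
  fix x assume "x \<in> p ` {1..m}"
  then show "x \<in> corners_of K m F" using assms(1) unfolding corners_of_def by blast
qed

section \<open>Locally finite families and galleries\<close>

text \<open>Each member meets a basic open set that meets only finitely many members, and there are
  countably many basic sets.\<close>

lemma locally_finite_countable:
  fixes \<F> :: "'a::second_countable_topology set set"
  assumes "\<And>F. F \<in> \<F> \<Longrightarrow> F \<noteq> {}"
    and "\<And>p. p \<in> \<Union>\<F> \<Longrightarrow> \<exists>U. open U \<and> p \<in> U \<and> finite {F \<in> \<F>. F \<inter> U \<noteq> {}}"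
  shows "countable \<F>"
proof -
  obtain B :: "'a set set" where B: "countable B" "topological_basis B"
    using ex_countable_basis by blast
  let ?B = "{U \<in> B. finite {F \<in> \<F>. F \<inter> U \<noteq> {}}}"
  have "\<F> \<subseteq> (\<Union>U\<in>?B. {F \<in> \<F>. F \<inter> U \<noteq> {}})"
  proof
    fix F assume F: "F \<in> \<F>"
    obtain p where p: "p \<in> F" using assms(1)[OF F] by blast
    obtain U where U: "open U" "p \<in> U" "finite {F \<in> \<F>. F \<inter> U \<noteq> {}}"
      using assms(2)[of p] p F by blast
    obtain W where W: "W \<in> B" "p \<in> W" "W \<subseteq> U" using topological_basisE[OF B(2) U(1,2)] by blast
    have "finite {F \<in> \<F>. F \<inter> W \<noteq> {}}"
      by (rule finite_subset[OF _ U(3)]) (use W in blast)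
    then show "F \<in> (\<Union>U\<in>?B. {F \<in> \<F>. F \<inter> U \<noteq> {}})" using W F p by blast
  qed
  moreover have "countable (\<Union>U\<in>?B. {F \<in> \<F>. F \<inter> U \<noteq> {}})"
    using B(1) by (intro countable_UN) (auto intro: countable_finite)
  ultimately show ?thesis by (rule countable_subset)
qed

text \<open>Local finiteness is available only at points of the closed set \<open>X\<close>;
  elsewhere the complement of \<open>X\<close> is a neighbourhood missing the union.\<close>

lemma locally_finite_closed_Union:
  fixes S :: "'a::topological_space set set"
  assumes "closed X" "\<Union>S \<subseteq> X" "\<And>F. F \<in> S \<Longrightarrow> closed F"
    and lf: "\<And>p. p \<in> X \<Longrightarrow> \<exists>U. open U \<and> p \<in> U \<and> finite {F \<in> S. F \<inter> U \<noteq> {}}"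
  shows "closed (\<Union>S)"
  unfolding closed_def
proof (rule Topological_Spaces.openI)
  fix p assume p: "p \<in> - \<Union>S"
  show "\<exists>T. open T \<and> p \<in> T \<and> T \<subseteq> - \<Union>S"
  proof (cases "p \<in> X")
    case True
    obtain U where U: "open U" "p \<in> U" "finite {F \<in> S. F \<inter> U \<noteq> {}}" using lf[OF True] by blast
    have "closed (\<Union>{F \<in> S. F \<inter> U \<noteq> {}})" using U(3) assms(3) by (intro closed_Union) auto
    then have "open (U - \<Union>{F \<in> S. F \<inter> U \<noteq> {}})" using U(1) by (rule open_Diff[rotated])
    then show ?thesis using U(2) p by (intro exI[of _ "U - \<Union>{F \<in> S. F \<inter> U \<noteq> {}}"]) blast
  next
    case False
    then show ?thesis using assms(1,2) by (intro exI[of _ "- X"]) auto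
  qed
qed

text \<open>Deleting the countably many corners leaves the surface connected, and any other point lies
  only on tiles that are pairwise adjacent along a side. So a set of tiles closed under adjacency
  and its complement cover this connected set by two disjoint closed sets.\<close>

lemma gallery_connected:
  assumes til: "geometric_tiling K m n \<F>" and "3 \<le> m"
    and S: "S \<subseteq> \<F>" "S \<noteq> {}"
    and adj: "\<And>F F'. F \<in> S \<Longrightarrow> F' \<in> \<F> \<Longrightarrow> F \<noteq> F' \<Longrightarrow>
       F \<inter> F' \<in> sides_of K m F \<inter> sides_of K m F' \<Longrightarrow> F' \<in> S"
  shows "S = \<F>"
proof (rule ccontr)
  assume "S \<noteq> \<F>"
  then obtain F1 where F1: "F1 \<in> \<F>" "F1 \<notin> S" using S by blast
  obtain F0 where F0: "F0 \<in> S" using S by blast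
  note til' = til[unfolded geometric_tiling_def]
  have reg: "\<exists>p. polygon_region K m p F" if "F \<in> \<F>" for F
    using til'[THEN conjunct1] that by (rule bspec)
  have cover: "\<Union>\<F> = surface K"
    using til'[THEN conjunct2, THEN conjunct2, THEN conjunct1] .
  have meet: "F \<inter> F' = {} \<or> (\<exists>v\<in>corners_of K m F \<inter> corners_of K m F'. F \<inter> F' = {v}) \<or>
      F \<inter> F' \<in> sides_of K m F \<inter> sides_of K m F'" if "F \<in> \<F>" "F' \<in> \<F>" "F \<noteq> F'" for F F'
    using til'[THEN conjunct2, THEN conjunct2, THEN conjunct2, THEN conjunct1, rule_format, OF that] .
  have lf: "\<exists>U. open U \<and> p \<in> U \<and> finite {F\<in>\<F>. F \<inter> U \<noteq> {}}" if "p \<in> surface K" for p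
    using til'[THEN conjunct2, THEN conjunct2, THEN conjunct2, THEN conjunct2, THEN conjunct2] that
    by (rule bspec)
  have unc: "uncountable F" if "F \<in> \<F>" for F
    using uncountable_polygon_region reg[OF that] \<open>3 \<le> m\<close> by blast
  have closed_tile: "closed F" if "F \<in> \<F>" for F
    using reg[OF that] closed_surface unfolding polygon_region_def ghull_def
    by (auto intro!: closed_Int closed_convex_cone_hull)
  have closed_Union: "closed (\<Union>R)" if R: "R \<subseteq> \<F>" for R
  proof (rule locally_finite_closed_Union[OF closed_surface])
    show "\<Union>R \<subseteq> surface K" using R cover by blast
    show "closed F" if "F \<in> R" for F using closed_tile that R by blast
    show "\<exists>U. open U \<and> p \<in> U \<and> finite {F \<in> R. F \<inter> U \<noteq> {}}" if p: "p \<in> surface K" for p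
    proof -
      obtain U where U: "open U" "p \<in> U" "finite {F\<in>\<F>. F \<inter> U \<noteq> {}}" using lf[OF p] by blast
      have "finite {F \<in> R. F \<inter> U \<noteq> {}}" by (rule finite_subset[OF _ U(3)]) (use R in blast)
      then show ?thesis using U by blast
    qed
  qed
  define V where "V = (\<Union>F\<in>\<F>. corners_of K m F)"
  have "countable \<F>"
    by (rule locally_finite_countable) (use unc lf cover in auto)
  moreover have "countable (corners_of K m F)" if F: "F \<in> \<F>" for F
  proof -
    obtain p where "polygon_region K m p F" using reg[OF F] by blast
    then show ?thesis using corners_of_eq \<open>3 \<le> m\<close> by (simp add: countable_finite)
  qed
  ultimately have V: "countable V" unfolding V_def by blast
  have "connected (surface K - V)" by (rule connected_surface_diff_countable[OF V])
  moreover have "closed (\<Union>S)" "closed (\<Union>(\<F> - S))" using closed_Union S by auto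
  moreover have "surface K - V \<subseteq> \<Union>S \<union> \<Union>(\<F> - S)" using cover by blast
  moreover have "\<Union>S \<inter> \<Union>(\<F> - S) \<inter> (surface K - V) = {}"
  proof (rule ccontr)
    assume "\<Union>S \<inter> \<Union>(\<F> - S) \<inter> (surface K - V) \<noteq> {}"
    then obtain p F F' where p: "p \<notin> V" "p \<in> F" "p \<in> F'" "F \<in> S" "F' \<in> \<F>" "F' \<notin> S" by blast
    then have F: "F \<in> \<F>" "F \<noteq> F'" using S by auto
    have "F \<inter> F' \<noteq> {}" using p by blast
    moreover have False if v: "v \<in> corners_of K m F \<inter> corners_of K m F'" "F \<inter> F' = {v}" for v
    proof -
      have "p = v" using v(2) p by blast
      then show False using v(1) F(1) p(1) unfolding V_def by blast
    qed
    ultimately have "F \<inter> F' \<in> sides_of K m F \<inter> sides_of K m F'"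
      using meet[OF F(1) p(5) F(2)] by (elim disjE bexE) auto
    then show False using adj[OF p(4,5) F(2)] p(6) by blast
  qed
  \<comment> \<open>Uncountability of a tile keeps both closed sets from lying inside the deleted
    points.\<close>
  moreover have "F - V \<noteq> {}" if "F \<in> \<F>" for F
    using unc[OF that] V by (metis Diff_eq_empty_iff countable_subset)
  then have "\<Union>S \<inter> (surface K - V) \<noteq> {}" "\<Union>(\<F> - S) \<inter> (surface K - V) \<noteq> {}"
    using F0 F1 S cover by blast+
  ultimately show False unfolding connected_closed by blast
qed

section \<open>Reflections of a placed tiling preserve edge labels\<close>

locale placed_tiling =
  fixes K :: geometry and m n :: nat and C :: mgon_cat and T :: "('v, 'e, 't) psh"
    and \<F> :: "point set set" and \<iota> :: "('v, 'e, 't) placement"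
  assumes m3: "3 \<le> m" and cat: "mgon_category m C" and psh: "presheaf m C T"
    and inj_bd: "\<And>x. x \<in> Tile T \<Longrightarrow> inj_on (\<lambda>i. bd T i x) {1..m}"
    and refl: "reflective m T"
    and til: "geometric_tiling K m n \<F>" and ident: "identification K m T \<F> \<iota>"
begin

text \<open>The numbering of corner positions that a tile brings along. That \<open>g\<close>
  preserves labels means \<open>P (tile_action T \<iota> g x) k = g (P x k)\<close>.\<close>

definition P :: "'t \<Rightarrow> nat \<Rightarrow> point" where
  "P x = (\<lambda>k. place0 \<iota> (corner T k x))"

lemma ds_dt: "k \<in> {1..m} \<Longrightarrow> {ds C k, dt C k} = {k, cyc_succ m k}"
  using cat by (simp add: mgon_category_def)

lemma bd_in: "x \<in> Tile T \<Longrightarrow> k \<in> {1..m} \<Longrightarrow> bd T k x \<in> Edge T"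
  using psh unfolding presheaf_def by (blast dest: funcset_mem)

lemma src_tgt_bd:
  assumes "x \<in> Tile T" "k \<in> {1..m}"
  shows "src T (bd T k x) = corner T (ds C k) x" "tgt T (bd T k x) = corner T (dt C k) x"
  using psh assms unfolding presheaf_def by blast+

lemma region: "x \<in> Tile T \<Longrightarrow> polygon_region K m (P x) (place2 \<iota> x)"
  using ident by (simp add: identification_def P_def)

lemma place2_bij: "bij_betw (place2 \<iota>) (Tile T) \<F>"
  using ident by (simp add: identification_def)

lemma place2_inj: "x \<in> Tile T \<Longrightarrow> y \<in> Tile T \<Longrightarrow> place2 \<iota> x = place2 \<iota> y \<Longrightarrow> x = y"
  using place2_bij by (auto simp: bij_betw_def dest: inj_onD)

lemma place2_surface: "x \<in> Tile T \<Longrightarrow> place2 \<iota> x \<subseteq> surface K"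
  using region[of x] ghull_subset_surface by (auto simp: polygon_region_def)

lemma P_surface: "x \<in> Tile T \<Longrightarrow> k \<in> {1..m} \<Longrightarrow> P x k \<in> surface K"
  using region[of x] regular_polygon_in by (auto simp: polygon_region_def)

lemma place1_bd:
  assumes "x \<in> Tile T" "k \<in> {1..m}"
  shows "place1 \<iota> (bd T k x) = ghull K {P x k, P x (cyc_succ m k)}"
proof -
  have "place1 \<iota> (bd T k x) = ghull K {place0 \<iota> (src T (bd T k x)), place0 \<iota> (tgt T (bd T k x))}"
    using ident bd_in[OF assms] by (simp add: identification_def)
  also have "{place0 \<iota> (src T (bd T k x)), place0 \<iota> (tgt T (bd T k x))} = P x ` {ds C k, dt C k}"
    by (simp add: src_tgt_bd[OF assms] P_def)
  finally show ?thesis by (simp add: ds_dt[OF assms(2)])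
qed

lemma place1_inj:
  assumes "e \<in> Edge T" "e' \<in> Edge T" "place1 \<iota> e = place1 \<iota> e'"
  shows "e = e'"
proof -
  have "inj_on (place1 \<iota>) (Edge T)" using ident by (simp add: identification_def bij_betw_def)
  then show ?thesis using assms(3,1,2) by (rule inj_onD)
qed

lemma polygon_side_is_edge:
  assumes "x \<in> Tile T" "polygon_region K m q (place2 \<iota> x)" "k \<in> {1..m}"
  obtains l where "l \<in> {1..m}" "ghull K {q k, q (cyc_succ m k)} = place1 \<iota> (bd T l x)"
proof -
  obtain l where l: "l \<in> {1..m}" "{q k, q (cyc_succ m k)} = {P x l, P x (cyc_succ m l)}"
    by (fact polygon_region_side[OF region[OF assms(1)] assms(2) m3 assms(3)])
  show thesis by (rule that[OF l(1)]) (simp only: l(2) place1_bd[OF assms(1) l(1)])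
qed

text \<open>Reflectivity provides some common label; injectivity of the boundary labels on
  \<open>x\<close> forces it to be \<open>k\<close>.\<close>

lemma common_edge_label:
  assumes "x \<in> Tile T" "y \<in> Tile T" "x \<noteq> y" "k \<in> {1..m}" "l \<in> {1..m}" "bd T k x = bd T l y"
  shows "bd T k y = bd T k x"
proof -
  have "bd T k x \<in> tile_edges m T x \<inter> tile_edges m T y"
    using assms unfolding tile_edges_def by (metis IntI imageI)
  then obtain i where i: "i \<in> {1..m}" "bd T k x = bd T i x" "bd T k x = bd T i y"
    using refl assms(1-3) unfolding reflective_def by blast
  have "k = i" using inj_onD[OF inj_bd[OF assms(1)] i(2) assms(4) i(1)] .
  then show ?thesis using i by simp
qed

lemma common_edge_corners:
  assumes "x \<in> Tile T" "y \<in> Tile T" "k \<in> {1..m}" "bd T k x = bd T k y"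
  shows "P x k = P y k" "P x (cyc_succ m k) = P y (cyc_succ m k)"
proof -
  \<comment> \<open>With equal labels, \<open>ds C k\<close> and \<open>dt C k\<close> name the
    source and the target in both tiles.\<close>
  have "\<forall>j\<in>{ds C k, dt C k}. P x j = P y j"
    using src_tgt_bd[OF assms(1,3)] src_tgt_bd[OF assms(2,3)] assms(4) by (simp add: P_def)
  then show "P x k = P y k" "P x (cyc_succ m k) = P y (cyc_succ m k)"
    unfolding ds_dt[OF assms(3)] by auto
qed

text \<open>An edge determines its source and target, so two tiles with a common edge agree on the
  labels of both its endpoints; this excludes the labelling with the two endpoints exchanged.\<close>

lemma polygon_along_edge:
  assumes "z \<in> Tile T" "y \<in> Tile T" "z \<noteq> y" and q: "polygon_region K m q (place2 \<iota> y)"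
    and k: "k \<in> {1..m}" "q k = P z k" "q (cyc_succ m k) = P z (cyc_succ m k)"
  shows "bd T k y = bd T k z" "\<And>j. j \<in> {1..m} \<Longrightarrow> P y j = q j"
proof -
  obtain l where l: "l \<in> {1..m}" "ghull K {q k, q (cyc_succ m k)} = place1 \<iota> (bd T l y)"
    by (fact polygon_side_is_edge[OF assms(2) q k(1)])
  have "place1 \<iota> (bd T k z) = place1 \<iota> (bd T l y)"
    using l(2) place1_bd[OF assms(1) k(1)] k(2,3) by simp
  then have "bd T k z = bd T l y"
    by (rule place1_inj[OF bd_in[OF assms(1) k(1)] bd_in[OF assms(2) l(1)]])
  then show e: "bd T k y = bd T k z"
    by (rule common_edge_label[OF assms(1-3) k(1) l(1)])
  show "P y j = q j" if "j \<in> {1..m}" for j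
    using polygon_region_agree[OF region[OF assms(2)] q m3 k(1) _ _ that]
      common_edge_corners[OF assms(2,1) k(1) e] k(2,3) by simp
qed

section \<open>Isometries acting on tiles\<close>

definition tiling_isometry :: "(point \<Rightarrow> point) \<Rightarrow> bool" where
  "tiling_isometry g \<longleftrightarrow> isometry K g \<and> (\<lambda>F. g ` F) ` \<F> = \<F>"

lemma tile_action:
  assumes "tiling_isometry g" "x \<in> Tile T"
  shows "tile_action T \<iota> g x \<in> Tile T" "place2 \<iota> (tile_action T \<iota> g x) = g ` place2 \<iota> x"
proof -
  have "place2 \<iota> x \<in> \<F>" using place2_bij assms(2) by (rule bij_betw_apply)
  then have "g ` place2 \<iota> x \<in> \<F>" using assms(1) unfolding tiling_isometry_def by blast
  then have "g ` place2 \<iota> x \<in> place2 \<iota> ` Tile T" using place2_bij by (simp add: bij_betw_def)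
  then show "tile_action T \<iota> g x \<in> Tile T" "place2 \<iota> (tile_action T \<iota> g x) = g ` place2 \<iota> x"
    unfolding tile_action_def by (rule inv_into_into, rule f_inv_into_f)
qed

lemma tile_action_region:
  assumes "tiling_isometry g" "x \<in> Tile T"
  shows "polygon_region K m (g \<circ> P x) (place2 \<iota> (tile_action T \<iota> g x))"
  unfolding tile_action(2)[OF assms]
  using assms polygon_region_isometry region by (simp add: tiling_isometry_def)

lemma tile_action_inj:
  assumes "tiling_isometry g" "x \<in> Tile T" "y \<in> Tile T"
    and "tile_action T \<iota> g x = tile_action T \<iota> g y"
  shows "x = y"
proof (rule place2_inj[OF assms(2,3)])
  have "inj_on g (surface K)" using assms(1) by (simp add: tiling_isometry_def isometry_def bij_betw_def)
  moreover have "g ` place2 \<iota> x = g ` place2 \<iota> y"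
    using tile_action(2)[OF assms(1,2)] tile_action(2)[OF assms(1,3)] assms(4) by simp
  ultimately show "place2 \<iota> x = place2 \<iota> y"
    using inj_on_image_eq_iff place2_surface assms(2,3) by metis
qed

text \<open>Stated for maps that agree on the surface, since that is where a group action
  composes.\<close>

lemma tile_action_comp:
  assumes "tiling_isometry h" "x \<in> Tile T" "\<And>p. p \<in> surface K \<Longrightarrow> gh p = g (h p)"
  shows "tile_action T \<iota> gh x = tile_action T \<iota> g (tile_action T \<iota> h x)"
proof -
  have "gh ` place2 \<iota> x = g ` h ` place2 \<iota> x"
    unfolding image_image by (rule image_cong) (use place2_surface assms in auto)
  then show ?thesis
    using tile_action(2)[OF assms(1,2)] by (simp add: tile_action_def)
qed

text \<open>The reflection fixes both ends of the side, so the image tile has this side too. Were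
  the image the base tile itself, its two numberings would agree everywhere and \<open>g\<close>
  would be the identity on the surface.\<close>

lemma reflection_preserves_labels:
  assumes g: "tiling_isometry g" and x0: "x0 \<in> Tile T" and i: "i \<in> {1..m}"
    and L: "place1 \<iota> (bd T i x0) \<subseteq> L" "is_reflection K L g"
  shows "tile_action T \<iota> g x0 \<noteq> x0"
    and "bd T i (tile_action T \<iota> g x0) = bd T i x0"
    and "\<And>k. k \<in> {1..m} \<Longrightarrow> P (tile_action T \<iota> g x0) k = g (P x0 k)"
proof -
  let ?y = "tile_action T \<iota> g x0"
  have i1: "cyc_succ m i \<in> {1..m}" using i by (rule cyc_succ_in)
  have "P x0 i \<in> place1 \<iota> (bd T i x0)" "P x0 (cyc_succ m i) \<in> place1 \<iota> (bd T i x0)"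
    unfolding place1_bd[OF x0 i] using P_surface[OF x0 i] P_surface[OF x0 i1]
    by (auto intro: ghull_inc)
  then have fixed: "g (P x0 i) = P x0 i" "g (P x0 (cyc_succ m i)) = P x0 (cyc_succ m i)"
    using L unfolding is_reflection_def by blast+
  have q: "polygon_region K m (g \<circ> P x0) (place2 \<iota> ?y)" by (rule tile_action_region[OF g x0])
  show ne: "?y \<noteq> x0"
  proof
    assume "?y = x0"
    then have "polygon_region K m (g \<circ> P x0) (place2 \<iota> x0)" using q by simp
    then have "(g \<circ> P x0) k = P x0 k" if "k \<in> {1..m}" for k
      by (rule polygon_region_agree[OF region[OF x0] _ m3 i _ _ that]) (simp_all add: fixed)
    then have "g p = p" if "p \<in> surface K" for p
      using isometry_fixing_polygon[of K g m "P x0" p] region[OF x0] g m3 that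
      by (simp add: tiling_isometry_def polygon_region_def)
    then show False using L(2) unfolding is_reflection_def by blast
  qed
  note along = polygon_along_edge[OF x0 tile_action(1)[OF g x0] ne[symmetric] q i]
  show "bd T i ?y = bd T i x0" by (rule along(1)) (simp_all add: fixed)
  show "P ?y k = g (P x0 k)" if "k \<in> {1..m}" for k
    using along(2)[OF _ _ that] fixed by simp
qed

text \<open>Induction along galleries. Carrying one label \<open>k\<close> for both tiles in the
  step is possible by \<open>common_edge_label\<close>.\<close>

lemma tile_induct [consumes 2, case_names base step]:
  assumes "x0 \<in> Tile T" "x \<in> Tile T" and base: "Q x0"
    and step: "\<And>x y k. x \<in> Tile T \<Longrightarrow> y \<in> Tile T \<Longrightarrow> x \<noteq> y \<Longrightarrow> k \<in> {1..m} \<Longrightarrow>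
      bd T k x = bd T k y \<Longrightarrow> Q x \<Longrightarrow> Q y"
  shows "Q x"
proof -
  let ?S = "place2 \<iota> ` {x \<in> Tile T. Q x}"
  have img: "place2 \<iota> ` Tile T = \<F>" using place2_bij by (simp add: bij_betw_def)
  have "?S = \<F>"
  proof (rule gallery_connected[OF til m3])
    show "?S \<subseteq> \<F>" using img by blast
    show "?S \<noteq> {}" using assms(1) base by blast
    fix F F' assume F: "F \<in> ?S" "F' \<in> \<F>" "F \<noteq> F'"
      and sides: "F \<inter> F' \<in> sides_of K m F \<inter> sides_of K m F'"
    obtain x where x: "x \<in> Tile T" "Q x" "F = place2 \<iota> x" using F(1) by blast
    obtain y where y: "y \<in> Tile T" "F' = place2 \<iota> y" using F(2) img by blast
    have side: "\<exists>l\<in>{1..m}. F \<inter> F' = place1 \<iota> (bd T l z)"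
      if "z \<in> Tile T" "F \<inter> F' \<in> sides_of K m (place2 \<iota> z)" for z
    proof -
      obtain q k where "F \<inter> F' = ghull K {q k, q (cyc_succ m k)}"
        "polygon_region K m q (place2 \<iota> z)" "k \<in> {1..m}"
        using \<open>F \<inter> F' \<in> sides_of K m (place2 \<iota> z)\<close> unfolding sides_of_def by blast
      then show ?thesis using polygon_side_is_edge[OF \<open>z \<in> Tile T\<close>, of q k] by metis
    qed
    obtain k where k: "k \<in> {1..m}" "F \<inter> F' = place1 \<iota> (bd T k x)"
      using side[OF x(1)] sides x(3) by blast
    obtain l where l: "l \<in> {1..m}" "F \<inter> F' = place1 \<iota> (bd T l y)"
      using side[OF y(1)] sides y(2) by blast
    have "bd T k x = bd T l y"
      using place1_inj[OF bd_in[OF x(1) k(1)] bd_in[OF y(1) l(1)]] k l by simp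
    moreover have "x \<noteq> y" using F(3) x y by blast
    ultimately have "Q y"
      using step[OF x(1) y(1) _ k(1) _ x(2)] common_edge_label[OF x(1) y(1) _ k(1) l(1)] by simp
    then show "F' \<in> ?S" using y by blast
  qed
  then have "place2 \<iota> x \<in> ?S" using assms(2) img by blast
  then obtain z where "z \<in> Tile T" "Q z" "place2 \<iota> x = place2 \<iota> z" by blast
  then show ?thesis using place2_inj[OF assms(2)] by blast
qed

text \<open>Labels and signs go through one induction: that the image of \<open>x\<close> keeps its
  labels shows which edge is crossed between the images, hence which factor of \<open>\<phi>\<close>
  appears.\<close>

lemma symmetric_wrt_reflection:
  assumes gen: "generated_by m T \<tau> \<phi>"
    and g: "tiling_isometry g" and x0: "x0 \<in> Tile T" and i: "i \<in> {1..m}"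
    and L: "place1 \<iota> (bd T i x0) \<subseteq> L" "is_reflection K L g"
  shows "symmetric_wrt m T \<tau> (at2 \<phi> i) (tile_action T \<iota> g)"
proof -
  let ?a = "tile_action T \<iota> g"
  note a = tile_action(1)[OF g]
  have cross: "at2 \<tau> y = tmult m (at2 \<phi> k) (at2 \<tau> x)"
    if "x \<in> Tile T" "y \<in> Tile T" "y \<noteq> x" "k \<in> {1..m}" "bd T k y = bd T k x" for x y k
  proof -
    have "bd T k x \<in> tile_edges m T y"
      unfolding tile_edges_def using that(4,5) by (metis imageI)
    then show ?thesis using gen that unfolding generated_by_def by blast
  qed
  note r = reflection_preserves_labels[OF g x0 i L]
  have "(\<forall>k\<in>{1..m}. P (?a x) k = g (P x k)) \<and> at2 \<tau> (?a x) = tmult m (at2 \<phi> i) (at2 \<tau> x)"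
    if "x \<in> Tile T" for x
    using x0 that
  proof (induction rule: tile_induct)
    case base
    show ?case using r(3) cross[OF x0 a[OF x0] r(1) i r(2)] by blast
  next
    case (step x y k)
    have ne: "?a x \<noteq> ?a y" using tile_action_inj[OF g step(1,2)] step(3) by blast
    have k1: "cyc_succ m k \<in> {1..m}" using step(4) by (rule cyc_succ_in)
    note c = common_edge_corners[OF step(1,2,4,5)]
    have eq: "(g \<circ> P y) k = P (?a x) k" "(g \<circ> P y) (cyc_succ m k) = P (?a x) (cyc_succ m k)"
      using step(6) step(4) k1 c by simp_all
    note along = polygon_along_edge[OF a[OF step(1)] a[OF step(2)] ne
        tile_action_region[OF g step(2)] step(4) eq]
    have "at2 \<tau> (?a y) = tmult m (at2 \<phi> k) (at2 \<tau> (?a x))"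
      by (rule cross[OF a[OF step(1)] a[OF step(2)] ne[symmetric] step(4) along(1)])
    also have "\<dots> = tmult m (at2 \<phi> k) (tmult m (at2 \<phi> i) (at2 \<tau> x))" using step(6) by simp
    \<comment> \<open>Commutativity of sign multiplication moves the factor of the reflection past
      that of the crossing.\<close>
    also have "\<dots> = tmult m (at2 \<phi> i) (tmult m (at2 \<phi> k) (at2 \<tau> x))"
      by (auto simp: tmult_def fun_eq_iff)
    also have "tmult m (at2 \<phi> k) (at2 \<tau> x) = at2 \<tau> y"
      by (rule cross[symmetric, OF step(1,2) step(3)[symmetric] step(4) step(5)[symmetric]])
    finally show ?case using along(2) by simp
  qed
  then show ?thesis by (simp add: symmetric_wrt_def)
qed

end

section \<open>Sign tuples as values of schemes and edge-reversals\<close>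

lemma dih_act_sign_tuples:
  assumes "\<delta> \<in> sign_tuples m"
  shows "dih_act m \<sigma> \<delta> \<in> sign_tuples m"
proof -
  have rot: "rot m a \<in> sign_tuples m" if "a \<in> sign_tuples m" for a
    unfolding sign_tuples_def rot_def
  proof (rule restrict_PiE_iff[THEN iffD2], rule ballI)
    fix i assume "i \<in> {1..m}"
    then show "a (cyc_succ m i) \<in> {1, - 1}"
      using PiE_mem[OF that[unfolded sign_tuples_def]] cyc_succ_in by blast
  qed
  have flip: "flip m \<delta> \<in> sign_tuples m"
    unfolding sign_tuples_def flip_def
  proof (rule restrict_PiE_iff[THEN iffD2], rule ballI)
    fix i assume "i \<in> {1..m}"
    then have "m + 1 - i \<in> {1..m}" by auto
    then have "\<delta> (m + 1 - i) \<in> {1, - 1}" using PiE_mem[OF assms[unfolded sign_tuples_def]] by blast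
    then show "- \<delta> (m + 1 - i) \<in> {1, - 1}" by auto
  qed
  have "(rot m ^^ k) a \<in> sign_tuples m" if "a \<in> sign_tuples m" for k a
    using that by (induction k) (auto intro: rot)
  then show ?thesis using assms flip by (simp add: dih_act_def)
qed

text \<open>Supplies the hypothesis under which \<open>\<phi>\<close> descends to the Coxeter
  group.\<close>

lemma reflection_scheme_sign_tuples:
  assumes "reflection_scheme m C \<phi>" "i \<in> {1..m}"
  shows "at2 \<phi> i \<in> sign_tuples m"
proof -
  obtain C'' \<Gamma> where "presheaf_map m (star m C) (Lambda_sub m C'' \<Gamma>) \<phi>"
    using assms(1) unfolding reflection_scheme_def by blast
  then have "at2 \<phi> \<in> Tile (star m C) \<rightarrow> Tile (Lambda_sub m C'' \<Gamma>)"
    by (simp add: presheaf_map_def)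
  moreover have "i \<in> Tile (star m C)" using assms(2) by (simp add: star_def)
  ultimately have "at2 \<phi> i \<in> Tile (Lambda_sub m C'' \<Gamma>)" by (rule funcset_mem)
  then obtain \<sigma> where \<sigma>: "at2 \<phi> i = tmult m (delta m C'') (dih_act m \<sigma> (delta m C''))"
    by (auto simp: Lambda_sub_def Lambda_on_def)
  have d: "delta m C'' \<in> sign_tuples m" by (auto simp: delta_def sign_tuples_def)
  show ?thesis
    unfolding \<sigma> tmult_def unfolding sign_tuples_def
  proof (rule restrict_PiE_iff[THEN iffD2], rule ballI)
    fix j assume j: "j \<in> {1..m}"
    have "delta m C'' j \<in> {1, - 1}" "dih_act m \<sigma> (delta m C'') j \<in> {1, - 1}"
      using PiE_mem[OF d[unfolded sign_tuples_def] j]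
        PiE_mem[OF dih_act_sign_tuples[OF d, unfolded sign_tuples_def] j] by auto
    then show "delta m C'' j * dih_act m \<sigma> (delta m C'') j \<in> {1, - 1}" by auto
  qed
qed

text \<open>Multiplying by \<open>ones m\<close> restricts a function to \<open>{1..m}\<close>;
  tiles of \<open>Lambda_cat m C C'\<close> are products, hence restricted already.\<close>

lemma tmult_ones_at2:
  assumes "presheaf_map m T (Lambda_cat m C C') \<tau>" "x \<in> Tile T"
  shows "tmult m (ones m) (at2 \<tau> x) = at2 \<tau> x"
proof -
  have "at2 \<tau> \<in> Tile T \<rightarrow> Tile (Lambda_cat m C C')"
    using assms(1) by (simp add: presheaf_map_def)
  then have "at2 \<tau> x \<in> Tile (Lambda_cat m C C')" using assms(2) by (rule funcset_mem)
  then show ?thesis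
    by (auto simp: Lambda_cat_def Lambda_on_def tmult_def ones_def fun_eq_iff)
qed

section \<open>Passage from generators to the whole Coxeter group\<close>

theorem corollary5p8:
  fixes m n :: nat
    and C C' :: mgon_cat
    and T :: "('v, 'e, 't) psh"
    and \<tau> :: "('v, 'e, 't, unit, int, nat \<Rightarrow> int) psh_map"
    and \<phi> :: "(nat \<times> nat, nat \<times> nat, nat, unit, int, nat \<Rightarrow> int) psh_map"
    and \<F> :: "point set set"
    and \<iota> :: "('v, 'e, 't) placement"
    and x0 :: 't
    and act :: "nat list set \<Rightarrow> point \<Rightarrow> point"
  assumes "m \<ge> 3" and "n > 0" and "4 dvd n"
    and "mgon_category m C" and "mgon_category m C'"
    and "directed_tiling m n C (S_space m n) T" and "reflective m T"
    and "presheaf_map m T (Lambda_cat m C C') \<tau>"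
    and "reflection_scheme m C \<phi>" and "generated_by m T \<tau> \<phi>"
    and "geometric_tiling (geometry_of m n) m n \<F>"
    and "identification (geometry_of m n) m T \<F> \<iota>"
    and "x0 \<in> Tile T"
    and "reflection_action (geometry_of m n) m n T \<F> \<iota> x0 act"
  shows "\<forall>\<gamma>\<in>carrier (coxeter_group m n).
           symmetric_wrt m T \<tau> (cox_hom m (at2 \<phi>) \<gamma>) (tile_action T \<iota> (act \<gamma>))"
proof
  fix \<gamma> assume "\<gamma> \<in> carrier (coxeter_group m n)"
  then obtain w where w: "w \<in> lists {1..m}" "\<gamma> = cox_class m n w"
    by (auto simp: coxeter_group_def)
  let ?K = "geometry_of m n" and ?G = "coxeter_group m n"
  note dt = assms(6)[unfolded directed_tiling_def]
  interpret placed_tiling ?K m n C T \<F> \<iota>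
  proof
    show "presheaf m C T" using dt by (rule conjunct1)
    show "inj_on (\<lambda>i. bd T i x) {1..m}" if "x \<in> Tile T" for x
      using dt[THEN conjunct2, THEN conjunct2, THEN conjunct1] that by blast
  qed (use assms in simp_all)
  note ra = assms(14)[unfolded reflection_action_def]
  interpret group_action ?G "surface ?K" act using ra by (rule conjunct1)
  have isom: "tiling_isometry (act \<gamma>)" if "\<gamma> \<in> carrier ?G" for \<gamma>
    using ra[THEN conjunct2, THEN conjunct1] that by (simp add: tiling_isometry_def)
  have in_G: "cox_class m n u \<in> carrier ?G" if "u \<in> lists {1..m}" for u
    using that by (simp add: coxeter_group_def)
  have signs: "at2 \<phi> i \<in> sign_tuples m" if "i \<in> {1..m}" for i
    using reflection_scheme_sign_tuples[OF assms(9) that] .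
  have refl: "symmetric_wrt m T \<tau> (at2 \<phi> i) (tile_action T \<iota> (act (cox_class m n [i])))"
    if i: "i \<in> {1..m}" for i
  proof -
    obtain L where L: "place1 \<iota> (bd T i x0) \<subseteq> L" "is_reflection ?K L (act (cox_class m n [i]))"
      using ra[THEN conjunct2, THEN conjunct2] i unfolding cox_gen_def by blast
    have "[i] \<in> lists {1..m}" using i by simp
    from in_G[OF this] show ?thesis
      by (rule symmetric_wrt_reflection[OF assms(10) isom assms(13) i L])
  qed
  \<comment> \<open>The induction runs over a word for \<open>\<gamma>\<close>, peeling off the
    generator that acts last.\<close>
  have "symmetric_wrt m T \<tau> (word_sign m (at2 \<phi>) w) (tile_action T \<iota> (act (cox_class m n w)))"
    using w(1)
  proof (induction w)
    case Nil
    have "\<one>\<^bsub>?G\<^esub> = cox_class m n []" by (simp add: coxeter_group_def)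
    \<comment> \<open>Off the surface the neutral element acts by the value
      \<open>undefined\<close>, so the identity on tiles uses that tiles lie in the surface.\<close>
    then have "act (cox_class m n []) = (\<lambda>p\<in>surface ?K. p)" using id_eq_one by simp
    then have "act (cox_class m n []) p = p" if "p \<in> surface ?K" for p using that by simp
    then have "tile_action T \<iota> (act (cox_class m n [])) x = x" if "x \<in> Tile T" for x
      using place2_surface[OF that] place2_bij that
      by (simp add: tile_action_def bij_betw_def subset_iff cong: image_cong)
    then show ?case
      by (simp add: symmetric_wrt_def word_sign_def tmult_ones_at2[OF assms(8)])
  next
    case (Cons i w)
    then have i: "i \<in> {1..m}" and w: "w \<in> lists {1..m}" by auto
    let ?g = "act (cox_class m n [i])" and ?h = "act (cox_class m n w)"
    have i': "[i] \<in> lists {1..m}" using i by simp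
    have "cox_class m n (i # w) = cox_class m n [i] \<otimes>\<^bsub>?G\<^esub> cox_class m n w"
      using coxeter_mult[OF i' w] by simp
    then have comp: "act (cox_class m n (i # w)) p = ?g (?h p)" if "p \<in> surface ?K" for p
      using composition_rule[OF that in_G[OF i'] in_G[OF w]] by simp
    show ?case
      unfolding symmetric_wrt_def
    proof
      fix x assume x: "x \<in> Tile T"
      have h: "tile_action T \<iota> ?h x \<in> Tile T" using tile_action(1)[OF isom[OF in_G[OF w]] x] .
      have "at2 \<tau> (tile_action T \<iota> (act (cox_class m n (i # w))) x) =
          at2 \<tau> (tile_action T \<iota> ?g (tile_action T \<iota> ?h x))"
        by (rule arg_cong[where f = "at2 \<tau>"], rule tile_action_comp[OF isom[OF in_G[OF w]] x])
          (rule comp)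
      also have "\<dots> = tmult m (at2 \<phi> i) (tmult m (word_sign m (at2 \<phi>) w) (at2 \<tau> x))"
        using refl[OF i] h Cons.IH x by (simp add: symmetric_wrt_def)
      also have "\<dots> = tmult m (word_sign m (at2 \<phi>) (i # w)) (at2 \<tau> x)"
        by (auto simp: word_sign_def tmult_def fun_eq_iff)
      finally show "at2 \<tau> (tile_action T \<iota> (act (cox_class m n (i # w))) x) =
          tmult m (word_sign m (at2 \<phi>) (i # w)) (at2 \<tau> x)" .
    qed
  qed
  \<comment> \<open>Here \<open>4 dvd n\<close> enters through \<open>cox_hom_class\<close>: the
    braid word has even exponent, so the product of signs along a word depends only on its
    class.\<close>
  then show "symmetric_wrt m T \<tau> (cox_hom m (at2 \<phi>) \<gamma>) (tile_action T \<iota> (act \<gamma>))"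
    using cox_hom_class[OF assms(3) signs w(1)] w(2) by simp
qed

end
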